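(* Let $T$ be a densely defined closed operator in $H$ which is one-to-one but not bounded. Then (1) $T$ is absolutely minimum attaining if and only if $T^*T$ is absolutely minimum attaining; (2) $T$ is absolutely minimum attaining if and only if its Moore-Penrose inverse $T^{\dagger}$ is a compact operator on $H$ (i.e. $T^\dagger$ is everywhere defined, bounded and compact).
   Context: $H$ is an infinite dimensional complex Hilbert space. For a densely defined closed operator $T$ with domain $D(T)\subseteq H$, and a closed subspace $M$ of $H$ with $D(T)\cap M\neq\{0\}$, $T|_M$ denotes the restriction of $T$ to $D(T)\cap M$ (regarded as a densely defined closed operator from the Hilbert space $\overline{D(T)\cap M}$), with minimum modulus $m(T|_M)=\inf\{\|Tx\|: x\in D(T)\cap M,\ \|x\|=1\}$. $T$ is called absolutely minimum attaining if for every closed subspace $M$ of $H$ with $D(T)\cap M\ne\{0\}$ there is $x_0\in D(T)\cap M$ with $\|x_0\|=1$ and $\|Tx_0\|=m(T|_M)$. The Moore-Penrose inverse $T^\dagger$ is the unique densely defined closed operator in $H$ with domain $D(T^\dagger)=R(T)\oplus R(T)^\perp$ such that $TT^\dagger y=P_{\overline{R(T)}}\,y$ for all $y\in D(T^\dagger)$, $T^\dagger Tx=P_{N(T)^\perp}\,x$ for all $x\in D(T)$, and $N(T^\dagger)=R(T)^\perp$. Here $N(\cdot)$, $R(\cdot)$ denote null space and range and $P_M$ the orthogonal projection onto the closed subspace $M$. *)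

theory Defs
  imports "HOL-Analysis.Analysis"
begin

text \<open>Complex Hilbert spaces. As in \<^class>\<open>real_inner\<close>, the norm is part of the class and is tied
  to the inner product, which is conjugate-linear in its first argument.\<close>

class complex_inner = real_normed_vector +
  fixes scaleC :: "complex \<Rightarrow> 'a \<Rightarrow> 'a"  (infixr \<open>*\<^sub>C\<close> 75)
    and cinner :: "'a \<Rightarrow> 'a \<Rightarrow> complex"
  assumes scaleR_scaleC: "scaleR r x = complex_of_real r *\<^sub>C x"
    and scaleC_add_right: "a *\<^sub>C (x + y) = a *\<^sub>C x + a *\<^sub>C y"
    and scaleC_add_left: "(a + b) *\<^sub>C x = a *\<^sub>C x + b *\<^sub>C x"
    and scaleC_scaleC: "a *\<^sub>C b *\<^sub>C x = (a * b) *\<^sub>C x"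
    and scaleC_one: "1 *\<^sub>C x = x"
    and cinner_commute: "cinner x y = cnj (cinner y x)"
    and cinner_add_left: "cinner (x + y) z = cinner x z + cinner y z"
    and cinner_scaleC_left: "cinner (a *\<^sub>C x) y = cnj a * cinner x y"
    and cinner_self: "cinner x x = complex_of_real ((norm x)\<^sup>2)"

class complex_hilbert_space = complex_inner + complete_space

global_interpretation complex_vector: vector_space "scaleC :: complex \<Rightarrow> 'a \<Rightarrow> 'a::complex_inner"
  defines csubspace = complex_vector.subspace
    and cspan = complex_vector.span
  by unfold_locales (simp_all add: scaleC_add_right scaleC_add_left scaleC_scaleC scaleC_one)

definition orthogonal_compl :: "'a::complex_inner set \<Rightarrow> 'a set" where
  "orthogonal_compl M = {x. \<forall>y\<in>M. cinner x y = 0}"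

definition ortho_proj :: "'a::complex_inner set \<Rightarrow> 'a \<Rightarrow> 'a" where
  "ortho_proj M x = (THE p. p \<in> M \<and> x - p \<in> orthogonal_compl M)"

text \<open>An operator in \<open>H\<close> is a partial function: \<^term>\<open>dom T\<close> is its domain, \<^term>\<open>ran T\<close> its range,
  \<open>T |` M\<close> its restriction to \<open>dom T \<inter> M\<close>, and \<open>S \<circ>\<^sub>m T\<close> the composition \<open>ST\<close> with its
  natural domain \<open>{x \<in> dom T. Tx \<in> dom S}\<close>.\<close>

definition linear_operator :: "('a::complex_inner \<rightharpoonup> 'a) \<Rightarrow> bool" where
  "linear_operator T \<longleftrightarrow> csubspace (dom T) \<and>
     (\<forall>x\<in>dom T. \<forall>y\<in>dom T. T (x + y) = Some (the (T x) + the (T y))) \<and>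
     (\<forall>a. \<forall>x\<in>dom T. T (a *\<^sub>C x) = Some (a *\<^sub>C the (T x)))"

definition densely_defined_closed :: "('a::complex_inner \<rightharpoonup> 'a) \<Rightarrow> bool" where
  "densely_defined_closed T \<longleftrightarrow>
     linear_operator T \<and> closure (dom T) = UNIV \<and> closed (Map.graph T)"

definition bounded_operator :: "('a::complex_inner \<rightharpoonup> 'a) \<Rightarrow> bool" where
  "bounded_operator T \<longleftrightarrow> (\<exists>C. \<forall>x\<in>dom T. norm (the (T x)) \<le> C * norm x)"

definition compact_operator :: "('a::complex_inner \<rightharpoonup> 'a) \<Rightarrow> bool" where
  "compact_operator T \<longleftrightarrow> linear_operator T \<and> dom T = UNIV \<and> bounded_operator T \<and>
     (\<forall>B. bounded B \<longrightarrow> compact (closure ((\<lambda>x. the (T x)) ` B)))"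

definition null_space :: "('a::complex_inner \<rightharpoonup> 'a) \<Rightarrow> 'a set" where
  "null_space T = {x. T x = Some 0}"

text \<open>For densely defined \<open>T\<close> the vector \<open>z\<close> below is unique if it exists.\<close>

definition adjoint_operator :: "('a::complex_inner \<rightharpoonup> 'a) \<Rightarrow> ('a \<rightharpoonup> 'a)" where
  "adjoint_operator T = (\<lambda>y.
     if \<exists>z. \<forall>x\<in>dom T. cinner (the (T x)) y = cinner x z
     then Some (THE z. \<forall>x\<in>dom T. cinner (the (T x)) y = cinner x z)
     else None)"

definition minimum_modulus :: "('a::complex_inner \<rightharpoonup> 'a) \<Rightarrow> real" where
  "minimum_modulus T = Inf {norm (the (T x)) | x. x \<in> dom T \<and> norm x = 1}"

definition absolutely_minimum_attaining :: "('a::complex_inner \<rightharpoonup> 'a) \<Rightarrow> bool" where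
  "absolutely_minimum_attaining T \<longleftrightarrow>
     (\<forall>M. csubspace M \<and> closed M \<and> dom T \<inter> M \<noteq> {0} \<longrightarrow>
        (\<exists>x\<in>dom T \<inter> M. norm x = 1 \<and> norm (the (T x)) = minimum_modulus (T |` M)))"

text \<open>The equations between partial functions below include the requirement that the
  compositions \<open>TS\<close> and \<open>ST\<close> are defined at the point in question.\<close>

definition is_moore_penrose_inverse ::
    "('a::complex_inner \<rightharpoonup> 'a) \<Rightarrow> ('a \<rightharpoonup> 'a) \<Rightarrow> bool" where
  "is_moore_penrose_inverse T S \<longleftrightarrow>
     densely_defined_closed S \<and>
     dom S = {u + v | u v. u \<in> ran T \<and> v \<in> orthogonal_compl (ran T)} \<and>
     (\<forall>y\<in>dom S. (T \<circ>\<^sub>m S) y = Some (ortho_proj (closure (ran T)) y)) \<and>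
     (\<forall>x\<in>dom T. (S \<circ>\<^sub>m T) x = Some (ortho_proj (orthogonal_compl (null_space T)) x)) \<and>
     null_space S = orthogonal_compl (ran T)"

definition moore_penrose_inverse :: "('a::complex_inner \<rightharpoonup> 'a) \<Rightarrow> ('a \<rightharpoonup> 'a)" where
  "moore_penrose_inverse T = (THE S. is_moore_penrose_inverse T S)"

end

theory Submission
  imports Defs
begin

text \<open>A closed unbounded operator \<open>A\<close> is absolutely minimum attaining if and only if its domain, with
  the graph norm, is compactly embedded in \<open>H\<close>.

  If the embedding is compact, a minimizing sequence of unit vectors in \<open>D(A) \<inter> M\<close> has a
  subsequence converging in \<open>H\<close>; by the parallelogram law for the positive form
  \<open>\<parallel>Au\<parallel>\<^sup>2 - m\<^sup>2\<parallel>u\<parallel>\<^sup>2\<close> its image under \<open>A\<close> is Cauchy, so the limit attains the minimum.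

  If the embedding is not compact and \<open>A\<close> is unbounded, then on every subspace of the domain of finite
  codimension the ratio \<open>\<parallel>Au\<parallel> / \<parallel>u\<parallel>\<close> takes all values above some \<open>R\<close> that does not depend on the subspace. Hence there is an
  orthonormal sequence with orthogonal images whose norms decrease strictly to \<open>R\<close>, and the minimum modulus
  is not attained on its closed span.

  Compactness of the embedding passes between \<open>T\<close> and \<open>T\<^sup>*T\<close> because \<open>1 + T\<^sup>*T\<close> is onto; for
  injective \<open>T\<close> it gives a lower bound for \<open>T\<close> and is equivalent to compactness of \<open>T\<^sup>\<dagger>\<close>.\<close>

section \<open>Compactness, inner products and orthogonal projections\<close>

text \<open>The obstacle is the orthogonality of the images: for fixed \<open>x k\<close>, the
  condition <A (x k), A u> = 0 on u is continuous for the graph norm, but in general not for the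
  norm of H. Finite codimension is therefore expressed by finite sets of graph-continuous
  functionals on \<open>D\<close>. One device supplies both ends of the range of ratios. Along a
  subsequence of a graph-bounded sequence the values of finitely many such functionals converge, so
  differences of late terms can be moved into the common kernel by an arbitrarily small correction
  in graph norm. For a separated sequence in the graph unit ball this gives ratios below a bound
  that depends on the separation alone, which is the origin of R; for vectors tending to 0 with
  images of norm 1 it gives arbitrarily large ratios. The intermediate value theorem fills the range
  between. To use the criterion for T*T as well, one must know that T*T is unbounded when T is; this
  is a separate argument, again through the surjectivity of 1 + T*T.\<close>

lemma separated_sequence:
  fixes S :: "'a::complete_space set"
  assumes "\<not> compact (closure S)"
  obtains \<epsilon> w where "\<epsilon> > 0" "\<And>n::nat. w n \<in> S" "\<And>m n. m < n \<Longrightarrow> \<epsilon> \<le> dist (w m) (w n)"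
proof -
  have "complete (closure S)"
    by (simp add: complete_eq_closed)
  with assms obtain e where e: "e > 0"
    and no_cover: "\<And>k. finite k \<Longrightarrow> \<not> closure S \<subseteq> (\<Union>x\<in>k. ball x e)"
    unfolding compact_eq_totally_bounded by blast
  \<comment> \<open>Halving the radius transfers the failure of covering from the closure to
    \<open>S\<close> itself: a finite union of closed balls is closed, so covering \<open>S\<close>
    it would cover the closure.\<close>
  have S_no_cover: "\<not> S \<subseteq> (\<Union>x\<in>k. cball x (e/2))" if "finite k" for k
  proof
    assume "S \<subseteq> (\<Union>x\<in>k. cball x (e/2))"
    moreover have "closed (\<Union>x\<in>k. cball x (e/2))"
      using that by auto
    ultimately have "closure S \<subseteq> (\<Union>x\<in>k. cball x (e/2))"
      by (rule closure_minimal)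
    moreover have "(\<Union>x\<in>k. cball x (e/2)) \<subseteq> (\<Union>x\<in>k. ball x e)"
      using e by (intro UN_mono) auto
    ultimately show False
      using no_cover[OF that] by blast
  qed
  let ?Q = "\<lambda>w n x. x \<in> S \<and> (\<forall>m < (n::nat). e/2 \<le> dist (w m) x)"
  have "\<exists>w. \<forall>n. ?Q w n (w n)"
  proof (rule dependent_wellorder_choice)
    fix n :: nat and w
    have "\<not> S \<subseteq> (\<Union>x\<in>w ` {..<n}. cball x (e/2))"
      by (rule S_no_cover) simp
    then show "\<exists>x. ?Q w n x"
      by (fastforce simp: subset_eq)
  qed simp
  then show thesis
    using e that[of "e/2"] by auto
qed

text \<open>A separated sequence has no Cauchy subsequence, so it is enough to test sequences in
  \<open>S\<close>; points of the closure need not be considered.\<close>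

lemma compact_closure_sequentially:
  fixes S :: "'a::complete_space set"
  assumes "\<And>w. (\<And>n::nat. w n \<in> S) \<Longrightarrow> \<exists>r::nat \<Rightarrow> nat. strict_mono r \<and> Cauchy (w \<circ> r)"
  shows "compact (closure S)"
proof (rule ccontr)
  assume "\<not> compact (closure S)"
  then obtain \<epsilon> w where *: "\<epsilon> > 0" "\<And>n::nat. w n \<in> S" "\<And>m n. m < n \<Longrightarrow> \<epsilon> \<le> dist (w m) (w n)"
    using separated_sequence by blast
  obtain r :: "nat \<Rightarrow> nat" where r: "strict_mono r" "Cauchy (w \<circ> r)"
    using assms *(2) by blast
  obtain N where "\<forall>m\<ge>N. \<forall>n\<ge>N. dist ((w \<circ> r) m) ((w \<circ> r) n) < \<epsilon>"
    using r(2) *(1) unfolding Cauchy_def by blast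
  then have "dist (w (r N)) (w (r (Suc N))) < \<epsilon>"
    by simp
  with *(3)[of "r N" "r (Suc N)"] r(1) show False
    by (auto simp: strict_mono_def)
qed

lemma compact_closure_subset:
  fixes S :: "'a::metric_space set"
  assumes "compact (closure S')" "S \<subseteq> S'"
  shows "compact (closure S)"
proof -
  have "closure S = closure S' \<inter> closure S"
    using closure_mono[OF assms(2)] by blast
  then show ?thesis
    using compact_Int_closed[OF assms(1), of "closure S"] by simp
qed

section \<open>Calculus of the complex inner product and the Cauchy-Schwarz inequality\<close>

lemma cinner_add_right: "cinner x (y + z) = cinner x y + cinner x z"
  by (metis cinner_commute cinner_add_left complex_cnj_add)

lemma cinner_scaleC_right: "cinner x (a *\<^sub>C y) = a * cinner x y"
  by (metis cinner_commute cinner_scaleC_left complex_cnj_cnj complex_cnj_mult)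

lemma scaleC_minus_one: "(-1) *\<^sub>C x = - x"
  by (metis complex_vector.scale_minus_left scaleC_one)

lemma cinner_minus_left: "cinner (- x) y = - cinner x y"
  using cinner_scaleC_left[of "-1" x y] by (simp add: scaleC_minus_one)

lemma cinner_minus_right: "cinner x (- y) = - cinner x y"
  using cinner_scaleC_right[of x "-1" y] by (simp add: scaleC_minus_one)

lemma cinner_diff_left: "cinner (x - y) z = cinner x z - cinner y z"
  using cinner_add_left[of x "-y" z] by (simp add: cinner_minus_left)

lemma cinner_diff_right: "cinner x (y - z) = cinner x y - cinner x z"
  using cinner_add_right[of x y "-z"] by (simp add: cinner_minus_right)

lemma cinner_zero_left [simp]: "cinner 0 x = 0"
  using cinner_diff_left[of 0 0 x] by simp

lemma cinner_zero_right [simp]: "cinner x 0 = 0"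
  using cinner_diff_right[of x 0 0] by simp

lemma cinner_sum_right: "cinner x (\<Sum>i\<in>I. f i) = (\<Sum>i\<in>I. cinner x (f i))"
  by (induction I rule: infinite_finite_induct) (simp_all add: cinner_add_right)

lemma cinner_eq_0_sym: "cinner x y = 0 \<longleftrightarrow> cinner y x = 0"
  by (metis cinner_commute complex_cnj_zero)

lemma cinner_self_eq_0: "cinner x x = 0 \<longleftrightarrow> x = 0"
  by (simp add: cinner_self)

lemma power2_norm_eq_cinner: "(norm x)\<^sup>2 = Re (cinner x x)"
  by (simp add: cinner_self)

lemma Re_cinner_commute: "Re (cinner x y) = Re (cinner y x)"
  by (metis cinner_commute complex_cnj(1) complex.sel(1) complex.exhaust_sel)

lemma norm_add_squared: "(norm (x + y))\<^sup>2 = (norm x)\<^sup>2 + 2 * Re (cinner x y) + (norm y)\<^sup>2"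
  using Re_cinner_commute[of x y]
  by (simp add: power2_norm_eq_cinner cinner_add_left cinner_add_right)

lemma norm_diff_squared: "(norm (x - y))\<^sup>2 = (norm x)\<^sup>2 - 2 * Re (cinner x y) + (norm y)\<^sup>2"
  using norm_add_squared[of x "-y"] by (simp add: cinner_minus_right)

lemma parallelogram_law:
  fixes x y :: "'a::complex_inner"
  shows "(norm (x + y))\<^sup>2 + (norm (x - y))\<^sup>2 = 2 * (norm x)\<^sup>2 + 2 * (norm y)\<^sup>2"
  by (simp add: norm_add_squared norm_diff_squared)

lemma norm_scaleC: "norm (a *\<^sub>C x) = cmod a * norm x"
proof -
  have "cinner (a *\<^sub>C x) (a *\<^sub>C x) = complex_of_real ((cmod a * norm x)\<^sup>2)"
    by (simp only: cinner_scaleC_left cinner_scaleC_right)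
      (simp add: cinner_self power_mult_distrib complex_norm_square[of a] mult_ac flip: of_real_power)
  then have "(norm (a *\<^sub>C x))\<^sup>2 = (cmod a * norm x)\<^sup>2"
    unfolding cinner_self of_real_eq_iff .
  then show ?thesis
    by (simp add: power2_eq_iff_nonneg)
qed

lemma Re_cinner_le: "Re (cinner x y) \<le> norm x * norm y"
proof (cases "x = 0 \<or> y = 0")
  case True
  then show ?thesis by auto
next
  case False
  let ?u = "scaleR (norm y) x" and ?v = "scaleR (norm x) y"
  have "0 \<le> (norm (?u - ?v))\<^sup>2"
    by simp
  also have "\<dots> = 2 * (norm x * norm y) * (norm x * norm y) - 2 * (norm x * norm y) * Re (cinner x y)"
    by (simp only: norm_diff_squared)
      (simp add: scaleR_scaleC cinner_scaleC_left cinner_scaleC_right power2_eq_square norm_scaleC algebra_simps)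
  finally have "(norm x * norm y) * Re (cinner x y) \<le> (norm x * norm y) * (norm x * norm y)"
    by simp
  then show ?thesis
    using False by (simp add: mult_le_cancel_left)
qed

lemma norm_cinner_le: "cmod (cinner x y) \<le> norm x * norm y"
proof (cases "cinner x y = 0")
  case False
  \<comment> \<open>The scalar of modulus 1 that rotates the inner product onto the positive real
    axis, which reduces the claim to the bound for the real part.\<close>
  define a where "a = cnj (sgn (cinner x y))"
  have "cmod a = 1"
    using False by (simp add: a_def norm_sgn)
  have "a * cinner x y = cmod (cinner x y)"
    unfolding a_def sgn_eq using False
    by (simp add: complex_norm_square power2_eq_square divide_simps mult.commute flip: of_real_mult)
       (metis complex_norm_square mult.commute of_real_mult power2_eq_square)
  then have "cmod (cinner x y) = Re (cinner x (a *\<^sub>C y))"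
    by (simp add: cinner_scaleC_right)
  also have "\<dots> \<le> norm x * norm (a *\<^sub>C y)"
    by (rule Re_cinner_le)
  finally show ?thesis
    using \<open>cmod a = 1\<close> by (simp add: norm_scaleC)
qed simp

lemma bounded_bilinear_cinner: "bounded_bilinear (cinner :: 'a::complex_inner \<Rightarrow> 'a \<Rightarrow> complex)"
proof
  show "\<exists>K. \<forall>a b::'a. cmod (cinner a b) \<le> norm a * norm b * K"
    by (rule exI[of _ 1]) (simp add: norm_cinner_le)
qed (simp_all add: cinner_add_left cinner_add_right scaleR_scaleC cinner_scaleC_left
    cinner_scaleC_right scaleR_conv_of_real)

lemmas tendsto_cinner = bounded_bilinear.tendsto[OF bounded_bilinear_cinner]

lemma bounded_linear_scaleC: "bounded_linear (\<lambda>x. a *\<^sub>C (x::'a::complex_inner))"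
  by (rule bounded_linear_intro[of _ "cmod a"])
    (simp_all add: scaleC_add_right scaleR_scaleC scaleC_scaleC mult.commute norm_scaleC)

section \<open>Subspaces, orthogonal complements and the projection theorem\<close>

lemma csubspace_diff: "csubspace M \<Longrightarrow> x \<in> M \<Longrightarrow> y \<in> M \<Longrightarrow> x - y \<in> M"
  by (rule complex_vector.subspace_diff)

lemma csubspace_scaleR: "csubspace M \<Longrightarrow> x \<in> M \<Longrightarrow> r *\<^sub>R x \<in> M"
  by (simp add: scaleR_scaleC complex_vector.subspace_scale)

lemma csubspace_closure:
  assumes "csubspace M"
  shows "csubspace (closure M)"
proof -
  have "x + y \<in> closure M" if xy: "x \<in> closure M" "y \<in> closure M" for x y
  proof -
    obtain f g where "\<forall>n. f n \<in> M" "f \<longlonglongrightarrow> x" "\<forall>n. g n \<in> M" "g \<longlonglongrightarrow> y"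
      using xy by (auto simp: closure_sequential)
    then show ?thesis
      unfolding closure_sequential
      by (intro exI[of _ "\<lambda>n. f n + g n"]) (auto intro: tendsto_add complex_vector.subspace_add[OF assms])
  qed
  moreover have "c *\<^sub>C x \<in> closure M" if x: "x \<in> closure M" for c x
  proof -
    obtain f where "\<forall>n. f n \<in> M" "f \<longlonglongrightarrow> x"
      using x by (auto simp: closure_sequential)
    then show ?thesis
      unfolding closure_sequential
      by (intro exI[of _ "\<lambda>n. c *\<^sub>C f n"])
        (auto intro: bounded_linear.tendsto[OF bounded_linear_scaleC] complex_vector.subspace_scale[OF assms])
  qed
  moreover have "0 \<in> closure M"
    using complex_vector.subspace_0[OF assms] closure_subset by blast
  ultimately show ?thesis
    unfolding complex_vector.subspace_def by blast
qed

lemma csubspace_orthogonal_compl: "csubspace (orthogonal_compl M)"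
  unfolding complex_vector.subspace_def orthogonal_compl_def
  by (auto simp: cinner_add_left cinner_scaleC_left)

lemma cinner_closure_eq_0:
  assumes "\<And>y. y \<in> M \<Longrightarrow> cinner x y = 0" "z \<in> closure M"
  shows "cinner x z = 0"
proof -
  obtain f where f: "\<forall>n. f n \<in> M" "f \<longlonglongrightarrow> z"
    using assms(2) by (auto simp: closure_sequential)
  have "(\<lambda>n. cinner x (f n)) \<longlonglongrightarrow> cinner x z"
    by (intro tendsto_cinner tendsto_const f)
  moreover have "(\<lambda>n. cinner x (f n)) = (\<lambda>n. 0)"
    using f assms by auto
  ultimately show ?thesis
    by (simp add: LIMSEQ_const_iff)
qed

lemma orthogonal_compl_closure: "orthogonal_compl (closure M) = orthogonal_compl M"
proof
  show "orthogonal_compl (closure M) \<subseteq> orthogonal_compl M"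
    using closure_subset unfolding orthogonal_compl_def by blast
  show "orthogonal_compl M \<subseteq> orthogonal_compl (closure M)"
    unfolding orthogonal_compl_def using cinner_closure_eq_0[of M] by blast
qed

lemma orthogonal_compl_disjoint:
  assumes "x \<in> closure M" "x \<in> orthogonal_compl M"
  shows "x = 0"
  using assms cinner_closure_eq_0[of M x x] by (auto simp: orthogonal_compl_def cinner_self_eq_0)

lemma norm_add_squared_orthogonal:
  assumes "cinner x y = 0"
  shows "(norm (x + y))\<^sup>2 = (norm x)\<^sup>2 + (norm y)\<^sup>2"
  using assms by (simp add: norm_add_squared)

text \<open>Subtracting from \<open>d\<close> its projection onto the line through \<open>y\<close>
  lowers the squared norm by |<d, y>|^2 / ||y||^2. The \<open>c\<close> in the proof is the
  coefficient <y, d> / ||y||^2 of that projection.\<close>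

lemma minimal_norm_imp_orthogonal:
  assumes "\<And>c. (norm d)\<^sup>2 \<le> (norm (d - c *\<^sub>C y))\<^sup>2"
  shows "cinner d y = 0"
proof (rule ccontr)
  assume ne: "cinner d y \<noteq> 0"
  then have y: "norm y > 0"
    by auto
  define t where "t = inverse ((norm y)\<^sup>2)"
  define c where "c = complex_of_real t * cinner y d"
  have eq: "t * (norm y)\<^sup>2 = 1"
    using y by (simp add: t_def)
  have "t > 0"
    using y by (simp add: t_def)
  have "cinner d (c *\<^sub>C y) = complex_of_real (t * (cmod (cinner d y))\<^sup>2)"
    using cinner_commute[of y d]
    by (simp add: c_def cinner_scaleC_right complex_norm_square[of "cinner d y"] flip: of_real_power)
  moreover have "cmod (cinner y d) = cmod (cinner d y)"
    by (metis cinner_commute complex_mod_cnj)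
  then have "norm (c *\<^sub>C y) = t * cmod (cinner d y) * norm y"
    using \<open>t > 0\<close> by (simp add: norm_scaleC c_def norm_mult)
  ultimately have "(norm (d - c *\<^sub>C y))\<^sup>2 =
      (norm d)\<^sup>2 - 2 * (t * (cmod (cinner d y))\<^sup>2) + (t * (cmod (cinner d y))\<^sup>2) * (t * (norm y)\<^sup>2)"
    by (simp only: norm_diff_squared) (simp add: power2_eq_square)
  with assms[of c] eq have "t * (cmod (cinner d y))\<^sup>2 \<le> 0"
    by simp
  with ne \<open>t > 0\<close> show False
    by (simp add: mult_le_0_iff)
qed

text \<open>A minimizing sequence for the distance is Cauchy by the parallelogram law, and
  minimality of its limit gives orthogonality. The sort is chosen so that the result also applies to
  \<open>'a \<times> 'a\<close>, where the graph of an operator lives.\<close>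

theorem orthogonal_projection_exists:
  fixes M :: "'a::{complex_inner,complete_space} set"
  assumes M: "csubspace M" "closed M"
  obtains p where "p \<in> M" "x - p \<in> orthogonal_compl M"
proof -
  define d where "d = (INF y\<in>M. (norm (x - y))\<^sup>2)"
  have bdd: "bdd_below ((\<lambda>y. (norm (x - y))\<^sup>2) ` M)"
    by (rule bdd_belowI2[of _ 0]) simp
  have ne: "M \<noteq> {}"
    using complex_vector.subspace_0[OF M(1)] by auto
  have d_le: "d \<le> (norm (x - y))\<^sup>2" if "y \<in> M" for y
    unfolding d_def using bdd that by (rule cINF_lower)
  have "\<exists>y\<in>M. (norm (x - y))\<^sup>2 < d + inverse (real (Suc n))" for n
  proof -
    have "d < d + inverse (real (Suc n))"
      by simp
    then show ?thesis
      unfolding d_def using cINF_less_iff[OF ne bdd] by blast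
  qed
  then obtain f where f: "\<And>n. f n \<in> M" "\<And>n. (norm (x - f n))\<^sup>2 < d + inverse (real (Suc n))"
    by metis
  have est: "(norm (f n - f m))\<^sup>2 \<le> 2 * inverse (real (Suc n)) + 2 * inverse (real (Suc m))" for m n
  proof -
    \<comment> \<open>The midpoint is again a competitor, so its squared distance from
      \<open>x\<close> is at least \<open>d\<close>; the parallelogram law then leaves little room
      for \<open>f n - f m\<close>.\<close>
    have "(1/2) *\<^sub>R (f n + f m) \<in> M"
      using f(1) M(1) by (intro csubspace_scaleR complex_vector.subspace_add)
    then have "d \<le> (norm (x - (1/2) *\<^sub>R (f n + f m)))\<^sup>2"
      by (rule d_le)
    also have "x - (1/2) *\<^sub>R (f n + f m) = (1/2) *\<^sub>R ((x - f n) + (x - f m))"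
      by (simp add: algebra_simps flip: scaleR_2)
    also have "(norm \<dots>)\<^sup>2 = (norm ((x - f n) + (x - f m)))\<^sup>2 / 4"
      by (simp add: power_divide)
    finally have "4 * d \<le> (norm ((x - f n) + (x - f m)))\<^sup>2"
      by simp
    moreover have "norm ((x - f n) - (x - f m)) = norm (f n - f m)"
      by (simp add: norm_minus_commute)
    ultimately show ?thesis
      using parallelogram_law[of "x - f n" "x - f m"] f(2)[of n] f(2)[of m] by simp
  qed
  have "Cauchy f"
  proof (rule metric_CauchyI)
    fix e :: real assume "e > 0"
    then obtain N where N: "inverse (real (Suc N)) < e\<^sup>2 / 4"
      using reals_Archimedean[of "e\<^sup>2/4"] by auto
    have "dist (f m) (f n) < e" if "m \<ge> N" "n \<ge> N" for m n
    proof -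
      have *: "inverse (real (Suc k)) < e\<^sup>2 / 4" if "k \<ge> N" for k
        by (rule le_less_trans[OF _ N]) (use that in \<open>simp add: divide_simps\<close>)
      have "(norm (f m - f n))\<^sup>2 < e\<^sup>2"
        using est[of m n] *[OF that(1)] *[OF that(2)] by linarith
      then show ?thesis
        using \<open>e > 0\<close> by (simp add: dist_norm power2_less_imp_less)
    qed
    then show "\<exists>N. \<forall>m\<ge>N. \<forall>n\<ge>N. dist (f m) (f n) < e"
      by blast
  qed
  then obtain p where p: "f \<longlonglongrightarrow> p"
    using Cauchy_convergent convergent_def by blast
  then have pM: "p \<in> M"
    using M(2) f(1) closed_sequentially by blast
  have "(\<lambda>n. (norm (x - f n))\<^sup>2) \<longlonglongrightarrow> (norm (x - p))\<^sup>2"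
    by (intro tendsto_intros p)
  moreover have "(\<lambda>n. d + inverse (real (Suc n))) \<longlonglongrightarrow> d + 0"
    by (intro tendsto_intros LIMSEQ_inverse_real_of_nat)
  ultimately have le_d: "(norm (x - p))\<^sup>2 \<le> d"
    using f(2) by (force intro: LIMSEQ_le less_imp_le)
  have "cinner (x - p) y = 0" if y: "y \<in> M" for y
  proof (rule minimal_norm_imp_orthogonal)
    fix c
    have "p + c *\<^sub>C y \<in> M"
      using M(1) pM y by (intro complex_vector.subspace_add complex_vector.subspace_scale)
    from le_d d_le[OF this] show "(norm (x - p))\<^sup>2 \<le> (norm (x - p - c *\<^sub>C y))\<^sup>2"
      unfolding diff_diff_eq by linarith
  qed
  then show thesis
    using that pM by (auto simp: orthogonal_compl_def)
qed

lemma ortho_proj_unique: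
  assumes "csubspace M" "p \<in> M" "x - p \<in> orthogonal_compl M"
  shows "ortho_proj M x = p"
  unfolding ortho_proj_def
proof (rule the_equality)
  fix q assume q: "q \<in> M \<and> x - q \<in> orthogonal_compl M"
  then have "(x - p) - (x - q) \<in> orthogonal_compl M"
    using assms(3) csubspace_diff[OF csubspace_orthogonal_compl] by blast
  moreover have "q - p \<in> M"
    using q assms by (intro csubspace_diff) auto
  ultimately have "q - p = 0"
    using closure_subset[of M] orthogonal_compl_disjoint[of "q - p" M] by auto
  then show "q = p"
    by simp
qed (use assms in simp)

lemma closed_csubspace_UNIV:
  fixes M :: "'a::{complex_inner,complete_space} set"
  assumes "csubspace M" "closed M" "orthogonal_compl M \<subseteq> {0}"
  shows "M = UNIV"
proof -
  have "x \<in> M" for x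
  proof -
    obtain p where "p \<in> M" "x - p \<in> orthogonal_compl M"
      using orthogonal_projection_exists[OF assms(1,2)] .
    with assms(3) show ?thesis
      by auto
  qed
  then show ?thesis
    by blast
qed

text \<open>With this instance the projection theorem can be applied to the graph of a closed
  operator, a closed subspace of the product.\<close>

instantiation prod :: (complex_inner, complex_inner) complex_inner
begin

definition scaleC_prod :: "complex \<Rightarrow> 'a \<times> 'b \<Rightarrow> 'a \<times> 'b" where
  "scaleC_prod a x = (a *\<^sub>C fst x, a *\<^sub>C snd x)"

definition cinner_prod :: "'a \<times> 'b \<Rightarrow> 'a \<times> 'b \<Rightarrow> complex" where
  "cinner_prod x y = cinner (fst x) (fst y) + cinner (snd x) (snd y)"

instance
proof
  fix x y :: "'a \<times> 'b"
  show "cinner x y = cnj (cinner y x)"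
    by (simp add: cinner_prod_def flip: cinner_commute)
  show "cinner x x = complex_of_real ((norm x)\<^sup>2)"
    by (simp add: cinner_prod_def cinner_self norm_prod_def flip: of_real_add of_real_power)
qed (simp_all add: cinner_prod_def scaleC_prod_def scaleR_prod_def scaleR_scaleC scaleC_add_right
    scaleC_add_left scaleC_scaleC scaleC_one cinner_add_left cinner_scaleC_left algebra_simps
    prod_eq_iff)

end

section \<open>Compact embedding of the domain\<close>

locale closed_operator =
  fixes T :: "'a::complex_hilbert_space \<rightharpoonup> 'a"
  assumes linear_T: "linear_operator T" and closed_T: "closed (Map.graph T)"
begin

abbreviation D where "D \<equiv> dom T"
abbreviation A where "A x \<equiv> the (T x)"

lemma csubspace_D: "csubspace D"
  using linear_T by (simp add: linear_operator_def)

lemma D_0 [simp]: "0 \<in> D"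
  using csubspace_D by (rule complex_vector.subspace_0)

lemma D_add: "x \<in> D \<Longrightarrow> y \<in> D \<Longrightarrow> x + y \<in> D"
  using csubspace_D by (rule complex_vector.subspace_add)

lemma D_diff: "x \<in> D \<Longrightarrow> y \<in> D \<Longrightarrow> x - y \<in> D"
  using csubspace_D by (rule complex_vector.subspace_diff)

lemma D_scaleC: "x \<in> D \<Longrightarrow> c *\<^sub>C x \<in> D"
  using csubspace_D by (rule complex_vector.subspace_scale)

lemma D_scaleR: "x \<in> D \<Longrightarrow> r *\<^sub>R x \<in> D"
  using csubspace_D by (rule csubspace_scaleR)

lemma A_add: "x \<in> D \<Longrightarrow> y \<in> D \<Longrightarrow> A (x + y) = A x + A y"
  using linear_T by (simp add: linear_operator_def)

lemma A_scaleC: "x \<in> D \<Longrightarrow> A (c *\<^sub>C x) = c *\<^sub>C A x"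
  using linear_T by (simp add: linear_operator_def)

lemma A_scaleR: "x \<in> D \<Longrightarrow> A (r *\<^sub>R x) = r *\<^sub>R A x"
  by (simp add: scaleR_scaleC A_scaleC)

lemma A_0 [simp]: "A 0 = 0"
  using A_scaleR[OF D_0, of 0] by simp

lemma A_diff: "x \<in> D \<Longrightarrow> y \<in> D \<Longrightarrow> A (x - y) = A x - A y"
  using A_add[of "x - y" y] by (simp add: D_diff)

lemma limit_in_D:
  assumes "\<And>n. x n \<in> D" "x \<longlonglongrightarrow> l" "(\<lambda>n. A (x n)) \<longlonglongrightarrow> m"
  shows "l \<in> D" "A l = m"
proof -
  have "(x n, A (x n)) \<in> Map.graph T" for n
    using assms(1)[of n] by (auto intro: in_graphI)
  moreover have "(\<lambda>n. (x n, A (x n))) \<longlonglongrightarrow> (l, m)"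
    using assms by (intro tendsto_Pair)
  ultimately have "(l, m) \<in> Map.graph T"
    by (rule closed_sequentially[OF closed_T])
  then show "l \<in> D" "A l = m"
    by (auto dest: in_graphD)
qed

text \<open>A norm on \<open>D\<close> equivalent to the Hilbertian graph norm; the sum form lets
  either summand be dropped in estimates.\<close>

definition gnorm where "gnorm x = norm x + norm (A x)"

lemma gnorm_nonneg: "0 \<le> gnorm x"
  by (simp add: gnorm_def)

lemma gnorm_add: "x \<in> D \<Longrightarrow> y \<in> D \<Longrightarrow> gnorm (x + y) \<le> gnorm x + gnorm y"
  unfolding gnorm_def by (simp add: A_add) (smt (verit) norm_triangle_ineq)

lemma gnorm_scaleC: "x \<in> D \<Longrightarrow> gnorm (c *\<^sub>C x) = cmod c * gnorm x"
  unfolding gnorm_def by (simp add: A_scaleC norm_scaleC algebra_simps)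

lemma minimum_attained_iff:
  "x \<in> D \<inter> M \<and> norm x = 1 \<and> norm (A x) = minimum_modulus (T |` M) \<longleftrightarrow>
    x \<in> D \<inter> M \<and> norm x = 1 \<and> (\<forall>y\<in>D \<inter> M. norm y = 1 \<longrightarrow> norm (A x) \<le> norm (A y))"
    (is "?l \<longleftrightarrow> ?r")
proof -
  let ?S = "{norm (A y) | y. y \<in> D \<inter> M \<and> norm y = 1}"
  have "{norm (the ((T |` M) x)) | x. x \<in> dom (T |` M) \<and> norm x = 1} = ?S"
    unfolding dom_restrict by (rule Collect_cong) (metis Int_iff restrict_in)
  then have m: "minimum_modulus (T |` M) = Inf ?S"
    by (simp add: minimum_modulus_def)
  have bdd: "bdd_below ?S"
    by (rule bdd_belowI[of _ 0]) auto
  show ?thesis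
  proof
    assume ?l
    then show ?r
      unfolding m using bdd by (auto intro!: cInf_lower)
  next
    assume r: ?r
    then have "Inf ?S = norm (A x)"
      by (intro cInf_eq_minimum) auto
    with r show ?l
      unfolding m by auto
  qed
qed

lemma absolutely_minimum_attaining_iff:
  "absolutely_minimum_attaining T \<longleftrightarrow>
     (\<forall>M. csubspace M \<and> closed M \<and> D \<inter> M \<noteq> {0} \<longrightarrow>
        (\<exists>x\<in>D \<inter> M. norm x = 1 \<and> (\<forall>y\<in>D \<inter> M. norm y = 1 \<longrightarrow> norm (A x) \<le> norm (A y))))"
proof -
  have *: "(\<exists>x\<in>D \<inter> M. norm x = 1 \<and> norm (A x) = minimum_modulus (T |` M)) \<longleftrightarrow>
      (\<exists>x\<in>D \<inter> M. norm x = 1 \<and> (\<forall>y\<in>D \<inter> M. norm y = 1 \<longrightarrow> norm (A x) \<le> norm (A y)))" for M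
    unfolding Bex_def conj_assoc using minimum_attained_iff[of _ M] by (simp only: conj_assoc)
  show ?thesis
    unfolding absolutely_minimum_attaining_def * ..
qed

text \<open>The set is the unit ball of \<open>D\<close> for the graph norm max(||x||, ||A x||); its
  relative compactness is meant in the norm of H.\<close>

definition compact_embedding where
  "compact_embedding \<longleftrightarrow> compact (closure {x \<in> D. norm x \<le> 1 \<and> norm (A x) \<le> 1})"

lemma convergent_subsequence:
  assumes "compact_embedding" "\<And>n. x n \<in> D" "\<And>n. norm (x n) \<le> b" "\<And>n. norm (A (x n)) \<le> b"
  obtains r :: "nat \<Rightarrow> nat" and l where "strict_mono r" "(x \<circ> r) \<longlonglongrightarrow> l"
proof -
  \<comment> \<open>Unlike \<open>b\<close>, which may be 0, \<open>c\<close> can be divided by when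
    the sequence is scaled into the unit ball.\<close>
  define c where "c = max b 1"
  have c: "c \<ge> 1" "b \<le> c"
    by (auto simp: c_def)
  have le: "norm (inverse c *\<^sub>R v) \<le> 1" if "norm v \<le> b" for v :: 'a
    using c that by (simp add: divide_simps)
  have "inverse c *\<^sub>R x n \<in> closure {x \<in> D. norm x \<le> 1 \<and> norm (A x) \<le> 1}" for n
  proof (rule subsetD[OF closure_subset], intro CollectI conjI)
    show "inverse c *\<^sub>R x n \<in> D"
      using assms(2) by (rule D_scaleR)
    show "norm (A (inverse c *\<^sub>R x n)) \<le> 1"
      unfolding A_scaleR[OF assms(2)] using assms(4) by (rule le)
    show "norm (inverse c *\<^sub>R x n) \<le> 1"
      using assms(3) by (rule le)
  qed
  then obtain l r where r: "strict_mono (r :: nat \<Rightarrow> nat)" "((\<lambda>n. inverse c *\<^sub>R x n) \<circ> r) \<longlonglongrightarrow> l"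
    using assms(1)[unfolded compact_embedding_def compact_def, rule_format, of "\<lambda>n. inverse c *\<^sub>R x n"]
    by auto
  then have "(\<lambda>n. c *\<^sub>R ((\<lambda>n. inverse c *\<^sub>R x n) \<circ> r) n) \<longlonglongrightarrow> c *\<^sub>R l"
    by (intro tendsto_intros)
  then have "(x \<circ> r) \<longlonglongrightarrow> c *\<^sub>R l"
    using c by (simp add: o_def)
  with r that show thesis by blast
qed

text \<open>Put q(u) = ||A u||^2 - m^2 ||u||^2, which is nonnegative on \<open>D \<inter> M\<close>
  by \<open>low\<close>. Dropping q(x i + x j) from the parallelogram law for q leaves q(x i - x j)
  \<le> 2 q(x i) + 2 q(x j), which is \<open>est\<close>; moreover q(x n) tends to 0.\<close>

lemma Cauchy_image_of_minimizing:
  assumes x: "\<And>n. x n \<in> D \<inter> M" and M: "csubspace M"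
    and unit: "\<And>n. norm (x n) = 1" and conv: "Cauchy x"
    and lim: "(\<lambda>n. norm (A (x n))) \<longlonglongrightarrow> m" and "m \<ge> 0"
    and low: "\<And>u. u \<in> D \<inter> M \<Longrightarrow> m * norm u \<le> norm (A u)"
  shows "Cauchy (\<lambda>n. A (x n))"
proof (rule metric_CauchyI)
  fix e :: real assume "e > 0"
  have est: "(norm (A (x i) - A (x j)))\<^sup>2 \<le>
      2 * ((norm (A (x i)))\<^sup>2 - m\<^sup>2) + 2 * ((norm (A (x j)))\<^sup>2 - m\<^sup>2) + m\<^sup>2 * (norm (x i - x j))\<^sup>2" for i j
  proof -
    have "x i + x j \<in> D \<inter> M"
      using x[of i] x[of j] M D_add complex_vector.subspace_add[of M] by auto
    from low[OF this] have "(m * norm (x i + x j))\<^sup>2 \<le> (norm (A (x i + x j)))\<^sup>2"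
      using \<open>m \<ge> 0\<close> by (intro power_mono) auto
    then have "m\<^sup>2 * (norm (x i + x j))\<^sup>2 \<le> (norm (A (x i) + A (x j)))\<^sup>2"
      using x by (simp add: A_add power_mult_distrib)
    moreover have "m\<^sup>2 * (norm (x i + x j))\<^sup>2 + m\<^sup>2 * (norm (x i - x j))\<^sup>2 = m\<^sup>2 * 4"
      using parallelogram_law[of "x i" "x j"] unit by (simp flip: distrib_left)
    ultimately show ?thesis
      using parallelogram_law[of "A (x i)" "A (x j)"] by simp
  qed
  have "(\<lambda>n. (norm (A (x n)))\<^sup>2 - m\<^sup>2) \<longlonglongrightarrow> m\<^sup>2 - m\<^sup>2"
    by (intro tendsto_intros lim)
  then have "eventually (\<lambda>n. (norm (A (x n)))\<^sup>2 - m\<^sup>2 < e\<^sup>2 / 8) sequentially"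
    using \<open>e > 0\<close> by (intro order_tendstoD) auto
  then obtain N1 where N1: "\<And>n. n \<ge> N1 \<Longrightarrow> (norm (A (x n)))\<^sup>2 - m\<^sup>2 < e\<^sup>2 / 8"
    by (auto simp: eventually_sequentially)
  \<comment> \<open>Each of the three summands of \<open>est\<close> receives at most e^2/4, so the
    total stays below e^2. The added 1 covers the case m = 0.\<close>
  define d where "d = e / (2 * (m + 1))"
  have d: "d > 0"
    using \<open>e > 0\<close> \<open>m \<ge> 0\<close> by (simp add: d_def)
  obtain N2 where N2: "\<And>i j. i \<ge> N2 \<Longrightarrow> j \<ge> N2 \<Longrightarrow> norm (x i - x j) < d"
    using conv d unfolding Cauchy_def dist_norm by meson
  have "dist (A (x i)) (A (x j)) < e" if "i \<ge> max N1 N2" "j \<ge> max N1 N2" for i j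
  proof -
    have "m * norm (x i - x j) \<le> m * d"
      using N2[of i j] that \<open>m \<ge> 0\<close> by (intro mult_left_mono) auto
    also have "\<dots> \<le> e / 2"
      using \<open>e > 0\<close> \<open>m \<ge> 0\<close> by (simp add: d_def divide_simps)
    finally have "(m * norm (x i - x j))\<^sup>2 \<le> (e/2)\<^sup>2"
      using \<open>m \<ge> 0\<close> by (intro power_mono) auto
    then have "m\<^sup>2 * (norm (x i - x j))\<^sup>2 \<le> e\<^sup>2 / 4"
      by (simp add: power_mult_distrib power_divide)
    moreover have "(norm (A (x i)))\<^sup>2 - m\<^sup>2 < e\<^sup>2 / 8" "(norm (A (x j)))\<^sup>2 - m\<^sup>2 < e\<^sup>2 / 8"
      using N1 that by auto
    moreover have "e\<^sup>2 > 0"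
      using \<open>e > 0\<close> by simp
    moreover have "a < E" if "r \<le> E / 4" "p < E / 8" "q < E / 8" "E > 0" "a \<le> 2 * p + 2 * q + r"
      for a p q r E :: real
      using that by linarith
    ultimately have "(norm (A (x i) - A (x j)))\<^sup>2 < e\<^sup>2"
      using est[of i j] by blast
    then show ?thesis
      using \<open>e > 0\<close> by (simp add: dist_norm power2_less_imp_less)
  qed
  then show "\<exists>N. \<forall>m\<ge>N. \<forall>n\<ge>N. dist (A (x m)) (A (x n)) < e"
    by blast
qed

theorem compact_embedding_imp_absolutely_minimum_attaining:
  assumes "compact_embedding"
  shows "absolutely_minimum_attaining T"
  unfolding absolutely_minimum_attaining_iff
proof (intro allI impI, elim conjE)
  fix M assume M: "csubspace M" "closed M" "D \<inter> M \<noteq> {0}"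
  define U where "U = {u \<in> D \<inter> M. norm u = 1}"
  have normalize: "inverse (norm u) *\<^sub>R u \<in> U" if "u \<in> D \<inter> M" "u \<noteq> 0" for u
    using that M(1) by (auto simp: U_def D_scaleR csubspace_scaleR)
  have "0 \<in> D \<inter> M"
    using complex_vector.subspace_0[OF M(1)] by simp
  with M(3) obtain z where "z \<in> D \<inter> M" "z \<noteq> 0"
    by blast
  then have ne: "U \<noteq> {}"
    using normalize by auto
  define m where "m = (INF u\<in>U. norm (A u))"
  have bdd: "bdd_below ((\<lambda>u. norm (A u)) ` U)"
    by (rule bdd_belowI2[of _ 0]) simp
  have m_le: "m \<le> norm (A u)" if "u \<in> U" for u
    unfolding m_def using bdd that by (rule cINF_lower)
  have "m \<ge> 0"
    unfolding m_def using ne by (rule cINF_greatest) (rule norm_ge_zero)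
  have low: "m * norm u \<le> norm (A u)" if u: "u \<in> D \<inter> M" for u
  proof (cases "u = 0")
    case False
    then show ?thesis
      using m_le[OF normalize[OF u]] u by (simp add: A_scaleR divide_simps)
  qed simp
  have "\<exists>u\<in>U. norm (A u) < m + inverse (real (Suc n))" for n
  proof -
    have "m < m + inverse (real (Suc n))"
      by simp
    then show ?thesis
      unfolding m_def using cINF_less_iff[OF ne bdd] by blast
  qed
  then obtain x where x: "\<And>n. x n \<in> U" "\<And>n. norm (A (x n)) < m + inverse (real (Suc n))"
    by metis
  have lim: "(\<lambda>n. norm (A (x n))) \<longlonglongrightarrow> m"
  proof (rule tendsto_sandwich)
    show "(\<lambda>n. m) \<longlonglongrightarrow> m"
      by simp
    show "(\<lambda>n. m + inverse (real (Suc n))) \<longlonglongrightarrow> m"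
      using tendsto_add[OF tendsto_const LIMSEQ_inverse_real_of_nat, of m] by simp
  qed (use x(2) m_le[OF x(1)] in \<open>auto intro!: always_eventually less_imp_le\<close>)
  have "norm (A (x n)) \<le> m + 1" for n
  proof -
    have "inverse (real (Suc n)) \<le> 1"
      by (simp add: divide_simps)
    with x(2)[of n] show ?thesis
      by linarith
  qed
  moreover have "x n \<in> D" "norm (x n) \<le> m + 1" for n
    using x(1) \<open>m \<ge> 0\<close> by (auto simp: U_def)
  ultimately obtain r l where r: "strict_mono r" "(x \<circ> r) \<longlonglongrightarrow> l"
    using convergent_subsequence[OF assms, of x "m + 1"] by metis
  have xr: "(x \<circ> r) n \<in> D \<inter> M" "norm ((x \<circ> r) n) = 1" for n
    using x(1) by (auto simp: U_def)
  have lim_r: "(\<lambda>n. norm (A ((x \<circ> r) n))) \<longlonglongrightarrow> m"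
    using LIMSEQ_subseq_LIMSEQ[OF lim r(1)] by (simp add: o_def)
  have "Cauchy (\<lambda>n. A ((x \<circ> r) n))"
    by (rule Cauchy_image_of_minimizing[OF xr(1) M(1) xr(2) LIMSEQ_imp_Cauchy[OF r(2)] lim_r \<open>m \<ge> 0\<close> low])
  then obtain y where y: "(\<lambda>n. A ((x \<circ> r) n)) \<longlonglongrightarrow> y"
    using Cauchy_convergent convergent_def by blast
  have l: "l \<in> D" "A l = y"
    using limit_in_D[OF _ r(2) y] xr(1) by auto
  have "l \<in> M"
    using closed_sequentially[OF M(2) _ r(2)] xr(1) by blast
  have "norm l = 1"
    using LIMSEQ_unique[OF tendsto_norm[OF r(2)]] xr(2) by auto
  have "norm (A l) = m"
    using LIMSEQ_unique[OF tendsto_norm[OF y] lim_r] l by simp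
  then show "\<exists>x\<in>D \<inter> M. norm x = 1 \<and> (\<forall>y\<in>D \<inter> M. norm y = 1 \<longrightarrow> norm (A x) \<le> norm (A y))"
    using l(1) \<open>l \<in> M\<close> \<open>norm l = 1\<close> m_le by (intro bexI[of _ l]) (auto simp: U_def)
qed

text \<open>Otherwise there are unit vectors whose images tend to 0. By compactness a subsequence
  converges, and by closedness its limit is a unit vector in the kernel.\<close>

lemma compact_embedding_imp_bounded_below:
  assumes "compact_embedding" "\<And>x. x \<in> D \<Longrightarrow> A x = 0 \<Longrightarrow> x = 0"
  shows "\<exists>c>0. \<forall>x\<in>D. norm x \<le> c * norm (A x)"
proof (rule ccontr)
  assume no: "\<not> ?thesis"
  have "\<exists>x\<in>D. norm x = 1 \<and> norm (A x) \<le> inverse (real (Suc n))" for n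
  proof -
    obtain x where x: "x \<in> D" "norm x > real (Suc n) * norm (A x)"
      using no by (metis not_le of_nat_0_less_iff zero_less_Suc)
    then have "x \<noteq> 0"
      using x(2) by (intro notI) simp
    with x show ?thesis
      by (intro bexI[of _ "inverse (norm x) *\<^sub>R x"]) (auto simp: D_scaleR A_scaleR divide_simps mult_ac)
  qed
  then obtain x where x: "\<And>n. x n \<in> D" "\<And>n. norm (x n) = 1" "\<And>n. norm (A (x n)) \<le> inverse (real (Suc n))"
    by metis
  have "norm (A (x n)) \<le> 1" for n
    using order_trans[OF x(3)[of n], of 1] by (simp add: divide_simps)
  then obtain r l where r: "strict_mono r" "(x \<circ> r) \<longlonglongrightarrow> l"
    using convergent_subsequence[OF assms(1), of x 1] x(1,2) by (metis order_refl)
  have "(\<lambda>n. A (x n)) \<longlonglongrightarrow> 0"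
    by (rule Lim_null_comparison[OF _ LIMSEQ_inverse_real_of_nat]) (use x(3) in \<open>auto intro: always_eventually\<close>)
  then have "(\<lambda>n. A ((x \<circ> r) n)) \<longlonglongrightarrow> 0"
    using LIMSEQ_subseq_LIMSEQ[OF _ r(1)] by (fastforce simp: o_def)
  then have "l \<in> D" "A l = 0"
    using limit_in_D[OF _ r(2)] x(1) by auto
  with assms(2) have "l = 0"
    by blast
  moreover have "norm l = 1"
    using LIMSEQ_unique[OF tendsto_norm[OF r(2)]] x(2) by auto
  ultimately show False
    by simp
qed

end

section \<open>Restrictions to subspaces of finite codimension\<close>

context closed_operator
begin

text \<open>Linear functionals on \<open>D\<close> that are continuous for the graph norm; nothing
  is required off \<open>D\<close>. Common kernels of finite sets of them play the role of the
  subspaces of finite codimension. The graph norm is what admits u |-> <a, A u> for every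
  \<open>a\<close>.\<close>

definition graph_functional :: "('a \<Rightarrow> complex) \<Rightarrow> bool" where
  "graph_functional f \<longleftrightarrow> (\<forall>x\<in>D. \<forall>y\<in>D. f (x + y) = f x + f y) \<and>
     (\<forall>c. \<forall>x\<in>D. f (c *\<^sub>C x) = c * f x) \<and> (\<exists>K\<ge>0. \<forall>x\<in>D. cmod (f x) \<le> K * gnorm x)"

lemma graph_functional_cinner: "graph_functional (\<lambda>x. cinner a x)"
  unfolding graph_functional_def
proof (intro conjI exI[of _ "norm a"] ballI)
  show "cmod (cinner a x) \<le> norm a * gnorm x" for x
    by (rule order_trans[OF norm_cinner_le]) (auto simp: gnorm_def intro!: mult_left_mono)
qed (auto simp: cinner_add_right cinner_scaleC_right)

lemma graph_functional_cinner_image: "graph_functional (\<lambda>x. cinner a (A x))"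
  unfolding graph_functional_def
proof (intro conjI exI[of _ "norm a"] ballI)
  show "cmod (cinner a (A x)) \<le> norm a * gnorm x" for x
    by (rule order_trans[OF norm_cinner_le]) (auto simp: gnorm_def intro!: mult_left_mono)
  show "cinner a (A (x + y)) = cinner a (A x) + cinner a (A y)" if "x \<in> D" "y \<in> D" for x y
    using that by (simp add: A_add cinner_add_right)
  show "\<forall>c. \<forall>x\<in>D. cinner a (A (c *\<^sub>C x)) = c * cinner a (A x)"
    by (simp add: A_scaleC cinner_scaleC_right)
qed simp

lemma graph_functional_add: "graph_functional f \<Longrightarrow> x \<in> D \<Longrightarrow> y \<in> D \<Longrightarrow> f (x + y) = f x + f y"
  and graph_functional_scaleC: "graph_functional f \<Longrightarrow> x \<in> D \<Longrightarrow> f (c *\<^sub>C x) = c * f x"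
  by (auto simp: graph_functional_def)

lemma graph_functional_diff:
  assumes "graph_functional f" "x \<in> D" "y \<in> D"
  shows "f (x - y) = f x - f y"
  using graph_functional_add[OF assms(1), of "x - y" y] assms by (simp add: D_diff)

text \<open>A vector on which finitely many functionals are small lies near their common kernel,
  with linear control. To add \<open>f\<close>, correct the approximation \<open>v\<close> obtained
  for \<Phi> by \<open>f v\<close> times a vector \<open>u\<close> that is killed by \<Phi> and
  normalized to \<open>f u = 1\<close>.\<close>

lemma approximate_by_kernel:
  assumes "finite \<Phi>" "\<forall>f\<in>\<Phi>. graph_functional f"
  shows "\<exists>C\<ge>0. \<forall>w\<in>D. \<exists>v\<in>D. (\<forall>f\<in>\<Phi>. f v = 0) \<and> gnorm (w - v) \<le> C * (\<Sum>f\<in>\<Phi>. cmod (f w))"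
  using assms
proof (induction \<Phi> rule: finite_induct)
  case empty
  show ?case
  proof (intro exI[of _ 0] conjI ballI)
    fix w assume "w \<in> D"
    then show "\<exists>v\<in>D. (\<forall>f\<in>{}. f v = 0) \<and> gnorm (w - v) \<le> 0 * (\<Sum>f\<in>{}. cmod (f w))"
      by (intro bexI[of _ w]) (simp_all add: gnorm_def)
  qed simp
next
  case (insert f \<Phi>)
  define S where "S = (\<lambda>w. \<Sum>g\<in>\<Phi>. cmod (g w))"
  have S: "S w \<ge> 0" for w
    by (simp add: S_def sum_nonneg)
  have sum_eq: "(\<Sum>g\<in>insert f \<Phi>. cmod (g w)) = cmod (f w) + S w" for w
    using insert by (simp add: S_def)
  obtain C where "C \<ge> 0" and C: "\<And>w. w \<in> D \<Longrightarrow> \<exists>v\<in>D. (\<forall>g\<in>\<Phi>. g v = 0) \<and> gnorm (w - v) \<le> C * S w"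
    using insert unfolding S_def by blast
  have f: "graph_functional f"
    using insert by simp
  show ?case
  proof (cases "\<exists>u\<in>D. (\<forall>g\<in>\<Phi>. g u = 0) \<and> f u \<noteq> 0")
    \<comment> \<open>Here \<open>f\<close> vanishes on the common kernel of \<Phi>, so the
      approximation for \<Phi> already serves.\<close>
    case False
    show ?thesis
      unfolding sum_eq
    proof (intro exI[of _ C] conjI ballI \<open>C \<ge> 0\<close>)
      fix w assume "w \<in> D"
      then obtain v where v: "v \<in> D" "\<forall>g\<in>\<Phi>. g v = 0" "gnorm (w - v) \<le> C * S w"
        using C by blast
      have "C * S w \<le> C * (cmod (f w) + S w)"
        using \<open>C \<ge> 0\<close> by (intro mult_left_mono) auto
      with v False show "\<exists>v\<in>D. (\<forall>g\<in>insert f \<Phi>. g v = 0) \<and> gnorm (w - v) \<le> C * (cmod (f w) + S w)"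
        by (intro bexI[of _ v]) auto
    qed
  next
    case True
    then obtain u0 where u0: "u0 \<in> D" "\<forall>g\<in>\<Phi>. g u0 = 0" "f u0 \<noteq> 0"
      by blast
    define u where "u = inverse (f u0) *\<^sub>C u0"
    have u: "u \<in> D" "\<forall>g\<in>\<Phi>. g u = 0" "f u = 1"
      using u0 insert.prems by (auto simp: u_def D_scaleC graph_functional_scaleC)
    obtain K where "K \<ge> 0" and K: "\<And>x. x \<in> D \<Longrightarrow> cmod (f x) \<le> K * gnorm x"
      using f by (auto simp: graph_functional_def)
    define G where "G = gnorm u"
    have "G \<ge> 0"
      by (simp add: G_def gnorm_nonneg)
    \<comment> \<open>The final estimate has coefficient \<open>G\<close> at
      \<open>cmod (f w)\<close> and \<open>C + K * C * G\<close> at \<open>S w\<close>;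
      \<open>C'\<close> dominates both.\<close>
    define C' where "C' = C + G + K * C * G"
    have "C' \<ge> 0"
      using \<open>C \<ge> 0\<close> \<open>G \<ge> 0\<close> \<open>K \<ge> 0\<close> by (simp add: C'_def)
    show ?thesis
      unfolding sum_eq
    proof (intro exI[of _ C'] conjI ballI \<open>C' \<ge> 0\<close>)
      fix w assume w: "w \<in> D"
      then obtain v where v: "v \<in> D" "\<forall>g\<in>\<Phi>. g v = 0" "gnorm (w - v) \<le> C * S w"
        using C by blast
      define v' where "v' = v - f v *\<^sub>C u"
      have v': "v' \<in> D"
        using v u by (simp add: v'_def D_diff D_scaleC)
      have zero: "\<forall>g\<in>insert f \<Phi>. g v' = 0"
      proof
        fix g assume g: "g \<in> insert f \<Phi>"
        then have "graph_functional g"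
          using insert.prems by blast
        then have "g v' = g v - f v * g u"
          unfolding v'_def using v(1) u(1) by (simp add: graph_functional_diff graph_functional_scaleC D_scaleC)
        then show "g v' = 0"
          using g u v by auto
      qed
      have "cmod (f v) = cmod (f w - f (w - v))"
        using f w v(1) by (simp add: graph_functional_diff)
      also have "\<dots> \<le> cmod (f w) + cmod (f (w - v))"
        by (rule norm_triangle_ineq4)
      also have "cmod (f (w - v)) \<le> K * gnorm (w - v)"
        using w v by (intro K D_diff)
      also have "\<dots> \<le> K * (C * S w)"
        using v(3) \<open>K \<ge> 0\<close> by (rule mult_left_mono)
      finally have fv: "cmod (f v) \<le> cmod (f w) + K * (C * S w)"
        by simp
      have "gnorm (w - v') = gnorm ((w - v) + f v *\<^sub>C u)"
        by (simp add: v'_def algebra_simps)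
      also have "\<dots> \<le> gnorm (w - v) + cmod (f v) * G"
        using gnorm_add[of "w - v" "f v *\<^sub>C u"] w v u by (simp add: D_diff D_scaleC gnorm_scaleC G_def)
      also have "\<dots> \<le> C * S w + (cmod (f w) + K * (C * S w)) * G"
        using v(3) fv \<open>G \<ge> 0\<close> by (intro add_mono mult_right_mono)
      also have "\<dots> = C * S w + G * cmod (f w) + (K * C * G) * S w"
        by (simp add: algebra_simps)
      also have "\<dots> \<le> C' * (cmod (f w) + S w)"
        using \<open>C \<ge> 0\<close> \<open>G \<ge> 0\<close> \<open>K \<ge> 0\<close> S[of w] unfolding C'_def by (simp add: algebra_simps)
      finally show "\<exists>v\<in>D. (\<forall>g\<in>insert f \<Phi>. g v = 0) \<and> gnorm (w - v) \<le> C' * (cmod (f w) + S w)"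
        using v' zero by blast
    qed
  qed
qed

lemma Cauchy_functionals_subsequence:
  assumes "finite \<Phi>" "\<forall>f\<in>\<Phi>. graph_functional f" "\<And>n. w n \<in> D" "\<And>n. gnorm (w n) \<le> b"
  shows "\<exists>r::nat \<Rightarrow> nat. strict_mono r \<and> (\<forall>f\<in>\<Phi>. convergent (\<lambda>n. f (w (r n))))"
  using assms(1,2)
proof (induction \<Phi> rule: finite_induct)
  case empty
  show ?case
    by (intro exI[of _ id]) (auto simp: strict_mono_def)
next
  case (insert f \<Phi>)
  then obtain r :: "nat \<Rightarrow> nat" where r: "strict_mono r" "\<forall>g\<in>\<Phi>. convergent (\<lambda>n. g (w (r n)))"
    by auto
  obtain K where "K \<ge> 0" and K: "\<And>x. x \<in> D \<Longrightarrow> cmod (f x) \<le> K * gnorm x"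
    using insert.prems by (auto simp: graph_functional_def)
  have "cmod (f (w (r n))) \<le> K * b" for n
    using K[OF assms(3)] mult_left_mono[OF assms(4) \<open>K \<ge> 0\<close>] by (rule order_trans)
  then have "bounded (range (\<lambda>n. f (w (r n))))"
    by (auto simp: bounded_iff)
  then obtain l and s :: "nat \<Rightarrow> nat" where s: "strict_mono s" "((\<lambda>n. f (w (r n))) \<circ> s) \<longlonglongrightarrow> l"
    using bounded_imp_convergent_subsequence by blast
  have "convergent (\<lambda>n. g (w ((r \<circ> s) n)))" if "g \<in> \<Phi>" for g
    using convergent_subseq_convergent[OF bspec[OF r(2) that] s(1)] by (simp add: o_def)
  moreover have "convergent (\<lambda>n. f (w ((r \<circ> s) n)))"
    using s(2) by (auto simp: o_def convergent_def)
  ultimately show ?case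
    using strict_mono_o[OF r(1) s(1)] by blast
qed

text \<open>On a subsequence along which all functionals converge, differences of late terms are
  almost annihilated, hence close to the common kernel. The lemma is applied to a separated sequence
  and to one that tends to 0 while its images do not.\<close>

lemma differences_approximate_by_kernel:
  assumes \<Phi>: "finite \<Phi>" "\<forall>f\<in>\<Phi>. graph_functional f" and w: "\<And>n. w n \<in> D" "\<And>n. gnorm (w n) \<le> b"
  shows "\<exists>r::nat \<Rightarrow> nat. strict_mono r \<and>
    (\<forall>\<delta>>0. \<exists>N. \<forall>m\<ge>N. \<forall>n\<ge>N. \<exists>v\<in>D. (\<forall>f\<in>\<Phi>. f v = 0) \<and> gnorm (w (r m) - w (r n) - v) < \<delta>)"
proof -
  obtain r :: "nat \<Rightarrow> nat" where r: "strict_mono r" "\<forall>f\<in>\<Phi>. convergent (\<lambda>n. f (w (r n)))"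
    using Cauchy_functionals_subsequence[where w = w, OF assms] by blast
  obtain C where "C \<ge> 0" and
    C: "\<And>w. w \<in> D \<Longrightarrow> \<exists>v\<in>D. (\<forall>f\<in>\<Phi>. f v = 0) \<and> gnorm (w - v) \<le> C * (\<Sum>f\<in>\<Phi>. cmod (f w))"
    using approximate_by_kernel[OF \<Phi>] by blast
  have "\<exists>N. \<forall>m\<ge>N. \<forall>n\<ge>N. \<exists>v\<in>D. (\<forall>f\<in>\<Phi>. f v = 0) \<and> gnorm (w (r m) - w (r n) - v) < \<delta>" if "\<delta> > 0" for \<delta>
  proof -
    \<comment> \<open>The two added 1s keep the denominator positive for C = 0 and for empty \<Phi>,
      and make the final comparison with \<delta> strict.\<close>
    define \<eta> where "\<eta> = \<delta> / ((C + 1) * (real (card \<Phi>) + 1))"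
    have "\<eta> > 0"
      using that \<open>C \<ge> 0\<close> by (simp add: \<eta>_def)
    have "\<exists>N. \<forall>m\<ge>N. \<forall>n\<ge>N. cmod (f (w (r m)) - f (w (r n))) < \<eta>" if "f \<in> \<Phi>" for f
      using convergent_Cauchy[OF bspec[OF r(2) that]] \<open>\<eta> > 0\<close> unfolding Cauchy_def dist_norm by blast
    then obtain N where N: "\<And>f m n. f \<in> \<Phi> \<Longrightarrow> m \<ge> N f \<Longrightarrow> n \<ge> N f \<Longrightarrow> cmod (f (w (r m)) - f (w (r n))) < \<eta>"
      by metis
    \<comment> \<open>The sum of the thresholds dominates each of them and, unlike a maximum, is
      meaningful for empty \<Phi>.\<close>
    have "\<exists>v\<in>D. (\<forall>f\<in>\<Phi>. f v = 0) \<and> gnorm (w (r m) - w (r n) - v) < \<delta>"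
      if mn: "m \<ge> sum N \<Phi>" "n \<ge> sum N \<Phi>" for m n
    proof -
      have "(\<Sum>f\<in>\<Phi>. cmod (f (w (r m) - w (r n)))) \<le> (\<Sum>f\<in>\<Phi>. \<eta>)"
      proof (rule sum_mono)
        fix f assume f: "f \<in> \<Phi>"
        then have "N f \<le> sum N \<Phi>"
          using \<Phi>(1) by (intro member_le_sum) auto
        then have "cmod (f (w (r m)) - f (w (r n))) < \<eta>"
          using mn f by (intro N) auto
        then show "cmod (f (w (r m) - w (r n))) \<le> \<eta>"
          using graph_functional_diff[of f] \<Phi>(2) f w(1) by simp
      qed
      then have "C * (\<Sum>f\<in>\<Phi>. cmod (f (w (r m) - w (r n)))) \<le> C * (real (card \<Phi>) * \<eta>)"
        using \<open>C \<ge> 0\<close> by (intro mult_left_mono) auto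
      also have "\<dots> < (C + 1) * ((real (card \<Phi>) + 1) * \<eta>)"
        using \<open>C \<ge> 0\<close> \<open>\<eta> > 0\<close> by (simp add: algebra_simps add_pos_nonneg)
      also have "\<dots> = \<delta>"
        using \<open>C \<ge> 0\<close> by (simp add: \<eta>_def divide_simps)
      finally show ?thesis
        using C[of "w (r m) - w (r n)"] w(1) D_diff by (meson le_less_trans)
    qed
    then show ?thesis by blast
  qed
  with r(1) show ?thesis by blast
qed

text \<open>Two terms of an \<epsilon>-separated sequence in the graph unit ball differ by a vector
  of norm at least \<epsilon> whose image has norm at most 2. Moving it into the kernel by less than
  \<epsilon>/2 in graph norm leaves norm at least \<epsilon>/2 and image at most 2 + \<epsilon>/2.
  The quotient is R; it is fixed before \<Phi> is chosen.\<close>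

lemma noncompact_on_kernels:
  assumes "\<not> compact_embedding"
  obtains R where "R > 0" "\<And>\<Phi>. finite \<Phi> \<Longrightarrow> \<forall>f\<in>\<Phi>. graph_functional f \<Longrightarrow>
      \<exists>v\<in>D. v \<noteq> 0 \<and> (\<forall>f\<in>\<Phi>. f v = 0) \<and> norm (A v) \<le> R * norm v"
proof -
  obtain \<epsilon> w where "\<epsilon> > 0" and w: "\<And>n::nat. w n \<in> {x \<in> D. norm x \<le> 1 \<and> norm (A x) \<le> 1}"
    and sep: "\<And>m n. m < n \<Longrightarrow> \<epsilon> \<le> dist (w m) (w n)"
    using separated_sequence[OF assms[unfolded compact_embedding_def]] by blast
  have wD: "w n \<in> D" "norm (w n) \<le> 1" "norm (A (w n)) \<le> 1" for n
    using w[of n] by auto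
  have gw: "gnorm (w n) \<le> 2" for n
    using wD[of n] by (simp add: gnorm_def)
  define R where "R = (2 + \<epsilon> / 2) / (\<epsilon> / 2)"
  have "R > 0"
    using \<open>\<epsilon> > 0\<close> by (simp add: R_def add_pos_pos)
  moreover have "\<exists>v\<in>D. v \<noteq> 0 \<and> (\<forall>f\<in>\<Phi>. f v = 0) \<and> norm (A v) \<le> R * norm v"
    if \<Phi>: "finite \<Phi>" "\<forall>f\<in>\<Phi>. graph_functional f" for \<Phi>
  proof -
    obtain r :: "nat \<Rightarrow> nat" where r: "strict_mono r" and
      approx: "\<And>\<delta>. \<delta> > 0 \<Longrightarrow> \<exists>N. \<forall>m\<ge>N. \<forall>n\<ge>N. \<exists>v\<in>D. (\<forall>f\<in>\<Phi>. f v = 0) \<and> gnorm (w (r m) - w (r n) - v) < \<delta>"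
      using differences_approximate_by_kernel[where w = w, OF \<Phi> wD(1) gw] by blast
    obtain N where N: "\<forall>m\<ge>N. \<forall>n\<ge>N. \<exists>v\<in>D. (\<forall>f\<in>\<Phi>. f v = 0) \<and> gnorm (w (r m) - w (r n) - v) < \<epsilon> / 2"
      using approx[of "\<epsilon> / 2"] \<open>\<epsilon> > 0\<close> by auto
    obtain v where v: "v \<in> D" "\<forall>f\<in>\<Phi>. f v = 0" "gnorm (w (r N) - w (r (Suc N)) - v) < \<epsilon> / 2"
      using N[rule_format, of N "Suc N"] by auto
    define d where "d = w (r N) - w (r (Suc N))"
    have "d \<in> D"
      using wD by (simp add: d_def D_diff)
    have "norm d \<ge> \<epsilon>"
      using sep[of "r N" "r (Suc N)"] r by (simp add: d_def dist_norm strict_mono_def)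
    have "A d = A (w (r N)) - A (w (r (Suc N)))"
      using wD by (simp add: d_def A_diff)
    then have "norm (A d) \<le> 2"
      using norm_triangle_ineq4[of "A (w (r N))" "A (w (r (Suc N)))"] wD(3)[of "r N"] wD(3)[of "r (Suc N)"]
      by simp
    have "norm (d - v) + norm (A d - A v) < \<epsilon> / 2"
      using v \<open>d \<in> D\<close> unfolding d_def[symmetric] gnorm_def by (simp add: A_diff)
    then have close: "norm (d - v) < \<epsilon> / 2" "norm (A d - A v) < \<epsilon> / 2"
      using norm_ge_zero[of "d - v"] norm_ge_zero[of "A d - A v"] by linarith+
    have nv: "norm v \<ge> \<epsilon> / 2"
      using close(1) \<open>norm d \<ge> \<epsilon>\<close> norm_triangle_ineq2[of d v] by linarith
    have "norm (A v) \<le> 2 + \<epsilon> / 2"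
      using close(2) \<open>norm (A d) \<le> 2\<close> norm_triangle_ineq2[of "A v" "A d"]
      by (simp add: norm_minus_commute)
    also have "\<dots> = R * (\<epsilon> / 2)"
      using \<open>\<epsilon> > 0\<close> by (simp add: R_def)
    also have "\<dots> \<le> R * norm v"
      using nv \<open>R > 0\<close> by (intro mult_left_mono) auto
    finally have "norm (A v) \<le> R * norm v" .
    moreover have "v \<noteq> 0"
      using nv \<open>\<epsilon> > 0\<close> by auto
    ultimately show ?thesis
      using v by blast
  qed
  ultimately show thesis
    using that by blast
qed

text \<open>Unboundedness gives vectors tending to 0 whose images have norm 1. No subsequence of the
  images is Cauchy, since by closedness its limit would be \<open>A 0 = 0\<close>. Hence there are
  arbitrarily short differences whose images stay away from 0, and these are moved into the
  kernel.\<close>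

lemma unbounded_on_kernels:
  assumes "\<not> bounded_operator T" and \<Phi>: "finite \<Phi>" "\<forall>f\<in>\<Phi>. graph_functional f" and "\<Lambda> > 0"
  shows "\<exists>v\<in>D. v \<noteq> 0 \<and> (\<forall>f\<in>\<Phi>. f v = 0) \<and> \<Lambda> * norm v \<le> norm (A v)"
proof -
  have "\<exists>x\<in>D. norm (A x) = 1 \<and> norm x \<le> inverse (real (Suc n))" for n
  proof -
    obtain x where x: "x \<in> D" "norm (A x) > real (Suc n) * norm x"
      using assms(1) unfolding bounded_operator_def by (meson not_le)
    then have "norm (A x) > 0"
      by (smt (verit) mult_nonneg_nonneg norm_ge_zero of_nat_0_le_iff)
    with x show ?thesis
      by (intro bexI[of _ "inverse (norm (A x)) *\<^sub>R x"]) (auto simp: D_scaleR A_scaleR divide_simps mult_ac)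
  qed
  then obtain w where w: "\<And>n. w n \<in> D" "\<And>n. norm (A (w n)) = 1" "\<And>n. norm (w n) \<le> inverse (real (Suc n))"
    by metis
  have gw: "gnorm (w n) \<le> 2" for n
    using w(2)[of n] order_trans[OF w(3)[of n], of 1] by (simp add: gnorm_def divide_simps)
  obtain r :: "nat \<Rightarrow> nat" where r: "strict_mono r" and
    approx: "\<And>\<delta>. \<delta> > 0 \<Longrightarrow> \<exists>N. \<forall>m\<ge>N. \<forall>n\<ge>N. \<exists>v\<in>D. (\<forall>f\<in>\<Phi>. f v = 0) \<and> gnorm (w (r m) - w (r n) - v) < \<delta>"
    using differences_approximate_by_kernel[where w = w, OF \<Phi> w(1) gw] by blast
  have "w \<longlonglongrightarrow> 0"
    by (rule Lim_null_comparison[OF _ LIMSEQ_inverse_real_of_nat]) (use w(3) in \<open>auto intro: always_eventually\<close>)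
  then have wr: "(\<lambda>n. w (r n)) \<longlonglongrightarrow> 0"
    using LIMSEQ_subseq_LIMSEQ[OF _ r] by (fastforce simp: o_def)
  have "\<not> Cauchy (\<lambda>n. A (w (r n)))"
  proof
    assume "Cauchy (\<lambda>n. A (w (r n)))"
    then obtain y where y: "(\<lambda>n. A (w (r n))) \<longlonglongrightarrow> y"
      using Cauchy_convergent convergent_def by blast
    then have "y = 0"
      using limit_in_D(2)[OF w(1) wr y] by simp
    moreover have "norm y = 1"
      using LIMSEQ_unique[OF tendsto_norm[OF y]] w(2) by auto
    ultimately show False by simp
  qed
  then obtain \<epsilon> where "\<epsilon> > 0" and not_Cauchy: "\<And>N. \<exists>m\<ge>N. \<exists>n\<ge>N. \<epsilon> \<le> norm (A (w (r m)) - A (w (r n)))"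
    unfolding Cauchy_def dist_norm not_less[symmetric] by blast
  \<comment> \<open>The first bound keeps the image of \<open>v\<close> at norm at least
    \<epsilon>/2. The second is for \<open>norm v < 3 * \<delta>\<close>, where 2\<delta> comes from
    the two short terms and \<delta> from the correction.\<close>
  define \<delta> where "\<delta> = min (\<epsilon> / 2) (\<epsilon> / (6 * \<Lambda>))"
  have "\<delta> > 0"
    using \<open>\<epsilon> > 0\<close> \<open>\<Lambda> > 0\<close> by (simp add: \<delta>_def)
  obtain N1 where N1: "\<forall>m\<ge>N1. \<forall>n\<ge>N1. \<exists>v\<in>D. (\<forall>f\<in>\<Phi>. f v = 0) \<and> gnorm (w (r m) - w (r n) - v) < \<delta>"
    using approx[OF \<open>\<delta> > 0\<close>] by blast
  obtain N2 where N2: "\<And>n. n \<ge> N2 \<Longrightarrow> norm (w (r n)) < \<delta>"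
    using LIMSEQ_D[OF wr \<open>\<delta> > 0\<close>] by auto
  obtain m n where mn: "m \<ge> max N1 N2" "n \<ge> max N1 N2" "\<epsilon> \<le> norm (A (w (r m)) - A (w (r n)))"
    using not_Cauchy by blast
  define d where "d = w (r m) - w (r n)"
  have "d \<in> D"
    using w by (simp add: d_def D_diff)
  obtain v where v: "v \<in> D" "\<forall>f\<in>\<Phi>. f v = 0" "gnorm (d - v) < \<delta>"
    using N1[rule_format, of m n] mn unfolding d_def by auto
  have "norm (d - v) + norm (A d - A v) < \<delta>"
    using v \<open>d \<in> D\<close> unfolding gnorm_def by (simp add: A_diff)
  then have close: "norm (d - v) < \<delta>" "norm (A d - A v) < \<delta>"
    using norm_ge_zero[of "d - v"] norm_ge_zero[of "A d - A v"] by linarith+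
  have "norm d < 2 * \<delta>"
    using N2[of m] N2[of n] mn norm_triangle_ineq4[of "w (r m)" "w (r n)"] by (simp add: d_def)
  then have nv: "norm v < 3 * \<delta>"
    using close(1) norm_triangle_ineq2[of v d] by (simp add: norm_minus_commute)
  have "norm (A d) \<ge> \<epsilon>"
    using mn(3) w(1) by (simp add: d_def A_diff)
  moreover have "\<delta> \<le> \<epsilon> / 2"
    by (simp add: \<delta>_def)
  ultimately have nAv: "norm (A v) \<ge> \<epsilon> / 2"
    using close(2) norm_triangle_ineq2[of "A d" "A v"] by linarith
  have "\<Lambda> * norm v \<le> \<Lambda> * (3 * \<delta>)"
    using nv \<open>\<Lambda> > 0\<close> by (intro mult_left_mono) auto
  also have "\<dots> \<le> \<Lambda> * (3 * (\<epsilon> / (6 * \<Lambda>)))"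
    using \<open>\<Lambda> > 0\<close> by (intro mult_left_mono) (auto simp: \<delta>_def)
  also have "\<dots> = \<epsilon> / 2"
    using \<open>\<Lambda> > 0\<close> by simp
  also note nAv
  finally have "\<Lambda> * norm v \<le> norm (A v)" .
  moreover have "v \<noteq> 0"
    using nAv \<open>\<epsilon> > 0\<close> by (intro notI) simp
  ultimately show ?thesis
    using v by blast
qed

text \<open>The intermediate value theorem is applied on the segment from \<open>u\<close> to
  \<open>v\<close>. The result is given as a combination of \<open>u\<close> and \<open>v\<close>,
  so that linear conditions satisfied by both are inherited.\<close>

lemma intermediate_ratio:
  assumes u: "u \<in> D" "u \<noteq> 0" "norm (A u) \<le> \<mu> * norm u"
    and v: "v \<in> D" "v \<noteq> 0" "\<nu> * norm v \<le> norm (A v)" and "\<mu> \<le> \<kappa>" "\<kappa> < \<nu>"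
  obtains a b x where "x = a *\<^sub>C u + b *\<^sub>C v" "norm x = 1" "norm (A x) = \<kappa>"
proof -
  define p where "p = (\<lambda>t::real. (1 - t) *\<^sub>R u + t *\<^sub>R v)"
  define q where "q = (\<lambda>t::real. (1 - t) *\<^sub>R A u + t *\<^sub>R A v)"
  have pD: "p t \<in> D" and q: "A (p t) = q t" for t
    using u v by (simp_all add: p_def q_def D_add D_scaleR A_add A_scaleR)
  define \<phi> where "\<phi> = (\<lambda>t. norm (q t) - \<kappa> * norm (p t))"
  have "continuous_on {0..1} \<phi>"
    unfolding \<phi>_def p_def q_def by (intro continuous_intros)
  moreover have "\<phi> 0 \<le> 0"
    using u(3) mult_right_mono[OF \<open>\<mu> \<le> \<kappa>\<close>, of "norm u"] by (simp add: \<phi>_def p_def q_def)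
  moreover have "\<phi> 1 \<ge> 0"
    using v(3) mult_right_mono[of \<kappa> \<nu> "norm v"] \<open>\<kappa> < \<nu>\<close> by (simp add: \<phi>_def p_def q_def)
  ultimately obtain t where "\<phi> t = 0"
    using IVT'[of \<phi> 0 0 1] by auto
  then have t: "norm (A (p t)) = \<kappa> * norm (p t)"
    by (simp add: \<phi>_def q)
  \<comment> \<open>If the segment passed through 0, then \<open>u\<close> and \<open>v\<close>
    would be proportional and have the same ratio, but their ratios are separated by \<mu> <
    \<nu>.\<close>
  have "p t \<noteq> 0"
  proof
    assume *: "p t = 0"
    then have "t *\<^sub>R v = (t - 1) *\<^sub>R u"
      by (simp add: p_def algebra_simps add_eq_0_iff2)
    moreover from this have "t \<noteq> 0"
      using u(2) by auto
    ultimately have "v = ((t - 1) / t) *\<^sub>R u"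
      by (metis divide_inverse_commute scaleR_one scaleR_scaleR left_inverse)
    then have vs: "v = s *\<^sub>R u" if "s = (t - 1) / t" for s
      using that by simp
    define s where "s = (t - 1) / t"
    have "norm (A v) = \<bar>s\<bar> * norm (A u)" "norm v = \<bar>s\<bar> * norm u"
      using vs[OF s_def] u(1) by (simp_all add: A_scaleR)
    then have "norm (A v) \<le> \<mu> * norm v"
      using mult_left_mono[OF u(3), of "\<bar>s\<bar>"] by (simp add: mult_ac)
    with v(3) have "\<nu> * norm v \<le> \<mu> * norm v"
      by linarith
    with v(2) \<open>\<mu> \<le> \<kappa>\<close> \<open>\<kappa> < \<nu>\<close> show False
      by simp
  qed
  define c where "c = inverse (norm (p t))"
  show thesis
  proof
    show "c *\<^sub>R p t = complex_of_real (c * (1 - t)) *\<^sub>C u + complex_of_real (c * t) *\<^sub>C v"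
      by (simp add: p_def scaleR_add_right flip: scaleR_scaleC del: of_real_mult of_real_diff)
    show "norm (c *\<^sub>R p t) = 1"
      using \<open>p t \<noteq> 0\<close> by (simp add: c_def)
    show "norm (A (c *\<^sub>R p t)) = \<kappa>"
      using \<open>p t \<noteq> 0\<close> pD t by (simp add: c_def A_scaleR)
  qed
qed

lemma exists_in_kernel_with_norm:
  assumes \<Phi>: "finite \<Phi>" "\<forall>f\<in>\<Phi>. graph_functional f" and "\<not> bounded_operator T"
    and u: "u \<in> D" "u \<noteq> 0" "\<forall>f\<in>\<Phi>. f u = 0" "norm (A u) \<le> \<kappa> * norm u"
  obtains x where "x \<in> D" "norm x = 1" "norm (A x) = \<kappa>" "\<forall>f\<in>\<Phi>. f x = 0"
proof -
  have "0 \<le> \<kappa>"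
    using u by (meson linorder_not_le mult_less_0_iff norm_ge_zero order_trans zero_less_norm_iff not_less)
  \<comment> \<open>The ratio \<kappa> + 1 is positive, as \<open>unbounded_on_kernels\<close>
    demands, and strictly above \<kappa>, as the interpolation demands.\<close>
  then obtain v where v: "v \<in> D" "v \<noteq> 0" "\<forall>f\<in>\<Phi>. f v = 0" "(\<kappa> + 1) * norm v \<le> norm (A v)"
    using unbounded_on_kernels[OF assms(3) \<Phi>, of "\<kappa> + 1"] by auto
  obtain a b x where x: "x = a *\<^sub>C u + b *\<^sub>C v" "norm x = 1" "norm (A x) = \<kappa>"
    using intermediate_ratio[OF u(1,2,4) v(1,2,4), of \<kappa>] by (metis order_refl less_add_one)
  have "x \<in> D"
    using u v by (simp add: x D_add D_scaleC)
  moreover have "\<forall>f\<in>\<Phi>. f x = 0"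
  proof
    fix f assume "f \<in> \<Phi>"
    then have "f u = 0" "f v = 0" "graph_functional f"
      using u(3) v(3) \<Phi>(2) by blast+
    then show "f x = 0"
      using u(1) v(1) by (simp add: x graph_functional_add graph_functional_scaleC D_scaleC)
  qed
  ultimately show thesis
    using that x by blast
qed

end

section \<open>Necessity of the compact embedding\<close>

text \<open>The linear span of the sequence, written with sums over initial segments so that
  Pythagoras follows by induction on their length.\<close>

definition finite_combinations :: "(nat \<Rightarrow> 'a::complex_inner) \<Rightarrow> 'a set" where
  "finite_combinations x = {\<Sum>k<n. c k *\<^sub>C x k | n c. True}"

lemma finite_combinationsI: "u = (\<Sum>k<n. c k *\<^sub>C x k) \<Longrightarrow> u \<in> finite_combinations x"
  unfolding finite_combinations_def by auto

lemma csubspace_finite_combinations: "csubspace (finite_combinations x)"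
proof -
  let ?S = "finite_combinations x"
  have extend: "(\<Sum>k<n. c k *\<^sub>C x k) = (\<Sum>k<N. (if k < n then c k else 0) *\<^sub>C x k)" if "n \<le> N" for n N c
    using that by (intro sum.mono_neutral_cong_left) auto
  have "u + v \<in> ?S" if uv: "u \<in> ?S" "v \<in> ?S" for u v
  proof -
    obtain n c m d where "u = (\<Sum>k<n. c k *\<^sub>C x k)" "v = (\<Sum>k<m. d k *\<^sub>C x k)"
      using uv by (auto simp: finite_combinations_def)
    then have "u + v = (\<Sum>k<max n m. ((if k < n then c k else 0) + (if k < m then d k else 0)) *\<^sub>C x k)"
      using extend[of n "max n m" c] extend[of m "max n m" d]
      by (simp add: scaleC_add_left flip: sum.distrib)
    then show ?thesis
      by (rule finite_combinationsI)
  qed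
  moreover have "a *\<^sub>C u \<in> ?S" if u: "u \<in> ?S" for a u
  proof -
    obtain n c where "u = (\<Sum>k<n. c k *\<^sub>C x k)"
      using u by (auto simp: finite_combinations_def)
    then have "a *\<^sub>C u = (\<Sum>k<n. (a * c k) *\<^sub>C x k)"
      by (simp add: complex_vector.scale_sum_right scaleC_scaleC)
    then show ?thesis
      by (rule finite_combinationsI)
  qed
  moreover have "0 \<in> ?S"
    unfolding finite_combinations_def by (auto intro!: exI[of _ 0])
  ultimately show ?thesis
    unfolding complex_vector.subspace_def by blast
qed

lemma in_finite_combinations: "x k \<in> finite_combinations x"
proof -
  have "x k = (\<Sum>j<Suc k. (if j = k then 1 else 0) *\<^sub>C x j)"
    by (simp add: scaleC_one)
  then show ?thesis
    by (rule finite_combinationsI)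
qed

lemma norm_sum_orthogonal_squared:
  assumes "\<And>i j. i \<noteq> j \<Longrightarrow> cinner (x i) (x j) = 0"
  shows "(norm (\<Sum>k<n. c k *\<^sub>C x k))\<^sup>2 = (\<Sum>k<n::nat. (cmod (c k))\<^sup>2 * (norm (x k))\<^sup>2)"
proof (induction n)
  case (Suc n)
  have "cinner (x n) (\<Sum>k<n. c k *\<^sub>C x k) = 0"
    using assms by (simp add: cinner_sum_right cinner_scaleC_right)
  then have "cinner (\<Sum>k<n. c k *\<^sub>C x k) (x n) = 0"
    by (rule cinner_eq_0_sym[THEN iffD1])
  then show ?case
    using Suc by (simp add: norm_add_squared_orthogonal cinner_scaleC_right norm_scaleC power_mult_distrib)
qed simp

context closed_operator
begin

lemma A_sum:
  assumes "\<And>k. x k \<in> D"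
  shows "(\<Sum>k<n::nat. c k *\<^sub>C x k) \<in> D \<and> A (\<Sum>k<n. c k *\<^sub>C x k) = (\<Sum>k<n. c k *\<^sub>C A (x k))"
  by (induction n) (simp_all add: assms D_add D_scaleC A_add A_scaleC)

text \<open>At each stage the earlier vectors impose finitely many graph-continuous conditions, two
  for each of them. Since R does not depend on the conditions, any prescribed norm \<kappa> n above
  it remains available however many have accumulated.\<close>

lemma orthogonal_sequence_with_norms:
  assumes "\<not> compact_embedding" "\<not> bounded_operator T"
  obtains R where "R > 0" "\<And>\<kappa>. (\<And>n::nat. R \<le> \<kappa> n) \<Longrightarrow> \<exists>x. \<forall>n. x n \<in> D \<and> norm (x n) = 1 \<and>
    norm (A (x n)) = \<kappa> n \<and> (\<forall>k<n. cinner (x k) (x n) = 0 \<and> cinner (A (x k)) (A (x n)) = 0)"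
proof -
  obtain R where "R > 0" and R: "\<And>\<Phi>. finite \<Phi> \<Longrightarrow> \<forall>f\<in>\<Phi>. graph_functional f \<Longrightarrow>
      \<exists>v\<in>D. v \<noteq> 0 \<and> (\<forall>f\<in>\<Phi>. f v = 0) \<and> norm (A v) \<le> R * norm v"
    by (rule noncompact_on_kernels[OF assms(1)]) (rule that)
  have "\<exists>x. \<forall>n. x n \<in> D \<and> norm (x n) = 1 \<and> norm (A (x n)) = \<kappa> n \<and>
      (\<forall>k<n. cinner (x k) (x n) = 0 \<and> cinner (A (x k)) (A (x n)) = 0)"
    if \<kappa>: "\<And>n. R \<le> \<kappa> n" for \<kappa> :: "nat \<Rightarrow> real"
  proof (rule dependent_wellorder_choice)
    fix n :: nat and x :: "nat \<Rightarrow> 'a"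
    define \<Phi> where "\<Phi> = (\<lambda>k v. cinner (x k) v) ` {..<n} \<union> (\<lambda>k v. cinner (A (x k)) (A v)) ` {..<n}"
    have \<Phi>: "finite \<Phi>" "\<forall>f\<in>\<Phi>. graph_functional f"
      by (auto simp: \<Phi>_def graph_functional_cinner graph_functional_cinner_image)
    obtain u where u: "u \<in> D" "u \<noteq> 0" "\<forall>f\<in>\<Phi>. f u = 0" "norm (A u) \<le> R * norm u"
      using R[OF \<Phi>] by blast
    have "norm (A u) \<le> \<kappa> n * norm u"
      using u(4) mult_right_mono[OF \<kappa>[of n], of "norm u"] by simp
    then obtain v where "v \<in> D" "norm v = 1" "norm (A v) = \<kappa> n" "\<forall>f\<in>\<Phi>. f v = 0"
      using exists_in_kernel_with_norm[OF \<Phi> assms(2) u(1-3)] by blast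
    then show "\<exists>v. v \<in> D \<and> norm v = 1 \<and> norm (A v) = \<kappa> n \<and>
        (\<forall>k<n. cinner (x k) v = 0 \<and> cinner (A (x k)) (A v) = 0)"
      by (intro exI[of _ v]) (auto simp: \<Phi>_def)
  qed auto
  with \<open>R > 0\<close> that show thesis
    by blast
qed

text \<open>On finite combinations \<open>u\<close> of the \<open>x j\<close>, each coefficient contributes at least
  \<open>\<bar>\<langle>x j, u\<rangle>\<bar>\<^sup>2 ((\<kappa> j)\<^sup>2 - a)\<close> to \<open>\<parallel>Au\<parallel>\<^sup>2 - a\<parallel>u\<parallel>\<^sup>2\<close>; this non-strict bound survives limits, and a nonzero
  vector of the closed span is not orthogonal to all \<open>x j\<close>.\<close>

lemma squared_norm_gt_on_closed_span:
  assumes x: "\<And>n. x n \<in> D" "\<And>n. norm (x n) = 1" and k: "\<And>n. norm (A (x n)) = \<kappa> n"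
    and orth: "\<And>i j. i \<noteq> j \<Longrightarrow> cinner (x i) (x j) = 0"
    and orthA: "\<And>i j. i \<noteq> j \<Longrightarrow> cinner (A (x i)) (A (x j)) = 0"
    and bd: "\<And>n. (\<kappa> n)\<^sup>2 \<le> b" and low: "\<And>n. a < (\<kappa> n)\<^sup>2"
    and s: "s \<in> closure (finite_combinations x)" "s \<noteq> 0"
  shows "a * (norm s)\<^sup>2 < (norm (A s))\<^sup>2"
proof -
  let ?S = "finite_combinations x"
  have "b \<ge> 0"
    using bd[of 0] zero_le_power2[of "\<kappa> 0"] by linarith
  have S: "u \<in> D \<and> (norm (A u))\<^sup>2 \<le> b * (norm u)\<^sup>2 \<and>
      (\<forall>j. a * (norm u)\<^sup>2 + (cmod (cinner (x j) u))\<^sup>2 * ((\<kappa> j)\<^sup>2 - a) \<le> (norm (A u))\<^sup>2)" if u: "u \<in> ?S" for u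
  proof -
    obtain n c where u: "u = (\<Sum>k<n. c k *\<^sub>C x k)"
      using u by (auto simp: finite_combinations_def)
    have nu: "(norm u)\<^sup>2 = (\<Sum>k<n. (cmod (c k))\<^sup>2)"
      unfolding u using norm_sum_orthogonal_squared[of x, OF orth] x(2) by simp
    have nAu: "(norm (A u))\<^sup>2 = (\<Sum>k<n. (cmod (c k))\<^sup>2 * (\<kappa> k)\<^sup>2)"
      unfolding u using norm_sum_orthogonal_squared[of "\<lambda>k. A (x k)", OF orthA] A_sum[of x, OF x(1)] k by simp
    have "(norm (A u))\<^sup>2 \<le> b * (norm u)\<^sup>2"
      unfolding nu nAu sum_distrib_left by (rule sum_mono) (simp add: bd mult.commute[of b] mult_left_mono)
    moreover have "a * (norm u)\<^sup>2 + (cmod (cinner (x j) u))\<^sup>2 * ((\<kappa> j)\<^sup>2 - a) \<le> (norm (A u))\<^sup>2" for j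
    proof -
      have "cinner (x j) u = (\<Sum>k<n. if k = j then c k else 0)"
        unfolding u cinner_sum_right cinner_scaleC_right
        using orth x(2) by (intro sum.cong) (auto simp: cinner_self)
      \<comment> \<open>The value 0 for j \<ge> n matters: the estimate is then uniform over all
        \<open>j\<close>, whatever the length of the combination.\<close>
      then have coeff: "cinner (x j) u = (if j < n then c j else 0)"
        by simp
      have "(cmod (cinner (x j) u))\<^sup>2 * ((\<kappa> j)\<^sup>2 - a) =
          (\<Sum>k<n. if k = j then (cmod (c k))\<^sup>2 * ((\<kappa> k)\<^sup>2 - a) else 0)"
        by (simp add: coeff)
      also have "\<dots> \<le> (\<Sum>k<n. (cmod (c k))\<^sup>2 * ((\<kappa> k)\<^sup>2 - a))"
        by (rule sum_mono) (simp add: low less_imp_le)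
      also have "\<dots> = (norm (A u))\<^sup>2 - a * (norm u)\<^sup>2"
        unfolding nu nAu by (simp add: sum_subtractf sum_distrib_left right_diff_distrib mult.commute)
      finally show ?thesis
        by simp
    qed
    ultimately show ?thesis
      using A_sum[of x, OF x(1)] u by simp
  qed
  obtain f where f: "\<And>n. f n \<in> ?S" "f \<longlonglongrightarrow> s"
    using s(1) by (auto simp: closure_sequential)
  \<comment> \<open>On finite combinations \<open>A\<close> is bounded by \<open>sqrt b\<close>;
    closedness of the graph then places every point of the closed span in \<open>D\<close>.\<close>
  have "Cauchy (\<lambda>n. A (f n))"
  proof (rule metric_CauchyI)
    fix e :: real assume "e > 0"
    define d where "d = e / (sqrt b + 1)"
    have "d > 0"
      using \<open>e > 0\<close> \<open>b \<ge> 0\<close> by (simp add: d_def add_nonneg_pos)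
    then obtain N where N: "\<And>i j. i \<ge> N \<Longrightarrow> j \<ge> N \<Longrightarrow> norm (f i - f j) < d"
      using LIMSEQ_imp_Cauchy[OF f(2)] unfolding Cauchy_def dist_norm by meson
    have "dist (A (f i)) (A (f j)) < e" if "i \<ge> N" "j \<ge> N" for i j
    proof -
      have "f i - f j \<in> ?S"
        using f(1) by (intro csubspace_diff csubspace_finite_combinations)
      with S have "(norm (A (f i - f j)))\<^sup>2 \<le> b * (norm (f i - f j))\<^sup>2"
        by blast
      then have "norm (A (f i - f j)) \<le> sqrt b * norm (f i - f j)"
        using real_sqrt_le_mono by (fastforce simp: real_sqrt_mult)
      also have "\<dots> \<le> sqrt b * d"
        using N[OF that] \<open>b \<ge> 0\<close> by (intro mult_left_mono) auto
      also have "\<dots> < (sqrt b + 1) * d"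
        using \<open>d > 0\<close> by simp
      also have "\<dots> = e"
        using add_nonneg_pos[OF real_sqrt_ge_zero[OF \<open>b \<ge> 0\<close>] zero_less_one] by (simp add: d_def)
      finally show ?thesis
        using S f(1) by (simp add: dist_norm A_diff)
    qed
    then show "\<exists>N. \<forall>i\<ge>N. \<forall>j\<ge>N. dist (A (f i)) (A (f j)) < e"
      by blast
  qed
  then obtain y where y: "(\<lambda>n. A (f n)) \<longlonglongrightarrow> y"
    using Cauchy_convergent convergent_def by blast
  have As: "s \<in> D" "A s = y"
    using limit_in_D[OF _ f(2) y] S f(1) by blast+
  have est: "a * (norm s)\<^sup>2 + (cmod (cinner (x j) s))\<^sup>2 * ((\<kappa> j)\<^sup>2 - a) \<le> (norm (A s))\<^sup>2" for j
  proof (rule LIMSEQ_le)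
    show "(\<lambda>n. a * (norm (f n))\<^sup>2 + (cmod (cinner (x j) (f n)))\<^sup>2 * ((\<kappa> j)\<^sup>2 - a)) \<longlonglongrightarrow>
        a * (norm s)\<^sup>2 + (cmod (cinner (x j) s))\<^sup>2 * ((\<kappa> j)\<^sup>2 - a)"
      by (intro tendsto_intros tendsto_cinner f)
    show "(\<lambda>n. (norm (A (f n)))\<^sup>2) \<longlonglongrightarrow> (norm (A s))\<^sup>2"
      unfolding As by (intro tendsto_intros y)
  qed (use S f(1) in blast)
  have "\<exists>j. cinner (x j) s \<noteq> 0"
  proof (rule ccontr)
    assume "\<not> ?thesis"
    then have *: "cinner s (x j) = 0" for j
      using cinner_eq_0_sym by blast
    have "s \<in> orthogonal_compl ?S"
      unfolding orthogonal_compl_def finite_combinations_def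
      by (auto simp: cinner_sum_right cinner_scaleC_right *)
    with s show False
      using orthogonal_compl_disjoint by blast
  qed
  then obtain j where "cinner (x j) s \<noteq> 0"
    by blast
  then have "0 < (cmod (cinner (x j) s))\<^sup>2 * ((\<kappa> j)\<^sup>2 - a)"
    using low[of j] by simp
  with est[of j] show ?thesis
    by linarith
qed

theorem absolutely_minimum_attaining_imp_compact_embedding:
  assumes unbdd: "\<not> bounded_operator T" and AM: "absolutely_minimum_attaining T"
  shows "compact_embedding"
proof (rule ccontr)
  assume "\<not> compact_embedding"
  then obtain R where "R > 0" and R: "\<And>\<kappa>. (\<And>n::nat. R \<le> \<kappa> n) \<Longrightarrow> \<exists>x. \<forall>n. x n \<in> D \<and> norm (x n) = 1 \<and>
    norm (A (x n)) = \<kappa> n \<and> (\<forall>k<n. cinner (x k) (x n) = 0 \<and> cinner (A (x k)) (A (x n)) = 0)"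
    using orthogonal_sequence_with_norms[OF _ unbdd] by blast
  \<comment> \<open>The values tend to R without reaching it and stay below R + 1. The first fact
    excludes attainment, the second bounds \<open>A\<close> on the span.\<close>
  define \<kappa> where "\<kappa> = (\<lambda>n::nat. R + inverse (real (Suc n)))"
  have \<kappa>_gt: "R < \<kappa> n" and \<kappa>_le: "\<kappa> n \<le> R + 1" for n
    using inverse_le_1_iff[of "real (Suc n)"] by (auto simp: \<kappa>_def)
  obtain x where x: "\<And>n. x n \<in> D" "\<And>n. norm (x n) = 1" "\<And>n. norm (A (x n)) = \<kappa> n"
    and orth_less: "\<And>n k. k < n \<Longrightarrow> cinner (x k) (x n) = 0 \<and> cinner (A (x k)) (A (x n)) = 0"
    using R[of \<kappa>] \<kappa>_gt less_imp_le by metis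
  have orth: "cinner (x i) (x j) = 0" "cinner (A (x i)) (A (x j)) = 0" if "i \<noteq> j" for i j
    using orth_less[of i j] orth_less[of j i] that cinner_eq_0_sym by (metis linorder_neqE_nat)+
  define M where "M = closure (finite_combinations x)"
  have M: "csubspace M" "closed M"
    by (simp_all add: M_def csubspace_closure csubspace_finite_combinations)
  have xM: "x n \<in> M" for n
    unfolding M_def using in_finite_combinations closure_subset by blast
  have "x 0 \<noteq> 0"
    using x(2)[of 0] by auto
  then have "D \<inter> M \<noteq> {0}"
    using x(1) xM by blast
  then obtain s where s: "s \<in> D" "s \<in> M" "norm s = 1"
    and min: "\<And>y. y \<in> D \<Longrightarrow> y \<in> M \<Longrightarrow> norm y = 1 \<Longrightarrow> norm (A s) \<le> norm (A y)"
    using AM M unfolding absolutely_minimum_attaining_iff by blast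
  have "\<kappa> \<longlonglongrightarrow> R"
    unfolding \<kappa>_def using tendsto_add[OF tendsto_const LIMSEQ_inverse_real_of_nat, of R] by simp
  then have "norm (A s) \<le> R"
    by (rule LIMSEQ_le_const) (use min x xM in metis)
  moreover have "R\<^sup>2 * (norm s)\<^sup>2 < (norm (A s))\<^sup>2"
  proof (rule squared_norm_gt_on_closed_span[of x \<kappa> "(R + 1)\<^sup>2"])
    show "(\<kappa> n)\<^sup>2 \<le> (R + 1)\<^sup>2" "R\<^sup>2 < (\<kappa> n)\<^sup>2" for n
      using \<kappa>_gt[of n] \<kappa>_le[of n] \<open>R > 0\<close> by (auto intro: power_mono power_strict_mono)
  qed (use x orth s M_def in auto)
  ultimately show False
    using s(3) \<open>R > 0\<close> by (simp add: power2_less_imp_less not_le[symmetric] power_mono)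
qed

end

section \<open>The composition with the adjoint and the Moore-Penrose inverse\<close>

lemma linear_operatorI:
  assumes "T 0 = Some 0"
    and add: "\<And>x y a b. T x = Some a \<Longrightarrow> T y = Some b \<Longrightarrow> T (x + y) = Some (a + b)"
    and scale: "\<And>c x a. T x = Some a \<Longrightarrow> T (c *\<^sub>C x) = Some (c *\<^sub>C a)"
  shows "linear_operator T"
  unfolding linear_operator_def complex_vector.subspace_def
  using assms by (auto simp: dom_def)

section \<open>The operator T*T and the resolvent of 1 + T*T\<close>

locale densely_defined_closed_operator = closed_operator T for T :: "'a::complex_hilbert_space \<rightharpoonup> 'a" +
  assumes dense: "closure (dom T) = UNIV"
begin

text \<open>The difference of two candidates is orthogonal to \<open>D\<close>, hence by density to
  itself; so the description operator in the definition denotes.\<close>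

lemma adjoint_operator_eq_Some_iff:
  "adjoint_operator T y = Some z \<longleftrightarrow> (\<forall>x\<in>D. cinner (A x) y = cinner x z)"
proof -
  have unique: "z = z'" if "\<forall>x\<in>D. cinner (A x) y = cinner x z" "\<forall>x\<in>D. cinner (A x) y = cinner x z'" for z z'
  proof -
    have "\<And>x. x \<in> D \<Longrightarrow> cinner (z - z') x = 0"
      using that cinner_eq_0_sym[of "z - z'"] by (simp add: cinner_diff_right)
    then have "cinner (z - z') (z - z') = 0"
      using cinner_closure_eq_0[of D "z - z'" "z - z'"] dense by blast
    then show ?thesis
      by (simp add: cinner_self_eq_0)
  qed
  show ?thesis
  proof
    assume l: "adjoint_operator T y = Some z"
    then have ex: "\<exists>z. \<forall>x\<in>D. cinner (A x) y = cinner x z"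
      by (auto simp: adjoint_operator_def split: if_splits)
    define P where "P = (\<lambda>z. \<forall>x\<in>D. cinner (A x) y = cinner x z)"
    have "z = The P"
      using l ex by (simp add: adjoint_operator_def P_def)
    moreover have "\<exists>!z. P z"
      unfolding P_def using ex unique by blast
    ultimately have "P z"
      by (simp add: theI')
    then show "\<forall>x\<in>D. cinner (A x) y = cinner x z"
      by (simp add: P_def)
  next
    assume r: "\<forall>x\<in>D. cinner (A x) y = cinner x z"
    then have "(THE z. \<forall>x\<in>D. cinner (A x) y = cinner x z) = z"
      using unique by (intro the_equality) auto
    with r show "adjoint_operator T y = Some z"
      by (auto simp: adjoint_operator_def)
  qed
qed

abbreviation T2 where "T2 \<equiv> adjoint_operator T \<circ>\<^sub>m T"

text \<open>The weak form of the equation T*T x = z. All later arguments about T*T go through this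
  pairing.\<close>

lemma T2_eq_Some_iff: "T2 x = Some z \<longleftrightarrow> x \<in> D \<and> (\<forall>u\<in>D. cinner (A u) (A x) = cinner u z)"
proof (cases "T x")
  case None
  then show ?thesis
    by (auto simp: map_comp_def)
next
  case (Some y)
  then show ?thesis
    by (auto simp: map_comp_def adjoint_operator_eq_Some_iff)
qed

lemma linear_T2: "linear_operator T2"
proof (rule linear_operatorI)
  show "T2 0 = Some 0"
    by (simp add: T2_eq_Some_iff)
  show "T2 (x + y) = Some (a + b)" if "T2 x = Some a" "T2 y = Some b" for x y a b
    using that unfolding T2_eq_Some_iff by (simp add: D_add A_add cinner_add_right)
  show "T2 (c *\<^sub>C x) = Some (c *\<^sub>C a)" if "T2 x = Some a" for c x a
    using that unfolding T2_eq_Some_iff by (simp add: D_scaleC A_scaleC cinner_scaleC_right)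
qed

lemma T2_diff:
  assumes "T2 x = Some a" "T2 y = Some b"
  shows "T2 (x - y) = Some (a - b)"
  using assms unfolding T2_eq_Some_iff by (simp add: D_diff A_diff cinner_diff_right)

lemma norm_A_squared:
  assumes "T2 x = Some z"
  shows "(norm (A x))\<^sup>2 = Re (cinner x z)"
  using assms unfolding T2_eq_Some_iff by (simp add: power2_norm_eq_cinner)

text \<open>The identity ||A x||^2 = Re <x, T*T x>, applied to differences, shows that the images
  \<open>A (x n)\<close> are Cauchy. Closedness of T identifies their limit, and the weak form
  passes to the limit.\<close>

lemma closed_graph_T2: "closed (Map.graph T2)"
  unfolding closed_sequential_limits
proof (intro allI impI, elim conjE)
  fix f l assume f: "\<forall>n::nat. f n \<in> Map.graph T2" and lim: "f \<longlonglongrightarrow> l"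
  define x z where "x = (\<lambda>n. fst (f n))" and "z = (\<lambda>n. snd (f n))"
  have xz: "T2 (x n) = Some (z n)" for n
    using f[rule_format, of n] unfolding x_def z_def by (intro in_graphD) (simp only: prod.collapse)
  have lims: "x \<longlonglongrightarrow> fst l" "z \<longlonglongrightarrow> snd l"
    unfolding x_def z_def by (intro tendsto_intros lim)+
  have xD: "x n \<in> D" for n
    using xz[of n] T2_eq_Some_iff by blast
  have est: "(norm (A (x m) - A (x n)))\<^sup>2 \<le> norm (x m - x n) * norm (z m - z n)" for m n
    using norm_A_squared[OF T2_diff[OF xz[of m] xz[of n]]] Re_cinner_le[of "x m - x n" "z m - z n"] xD
    by (simp add: A_diff)
  obtain b where "b > 0" and b: "\<And>n. norm (z n) \<le> b"
    using Bseq_def convergent_imp_Bseq lims(2) convergent_def by metis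
  have "Cauchy (\<lambda>n. A (x n))"
  proof (rule metric_CauchyI)
    fix e :: real assume "e > 0"
    then have "e\<^sup>2 / (2 * b) > 0"
      using \<open>b > 0\<close> by simp
    then obtain N where N: "\<And>m n. m \<ge> N \<Longrightarrow> n \<ge> N \<Longrightarrow> norm (x m - x n) < e\<^sup>2 / (2 * b)"
      using LIMSEQ_imp_Cauchy[OF lims(1)] unfolding Cauchy_def dist_norm by meson
    have "dist (A (x m)) (A (x n)) < e" if "m \<ge> N" "n \<ge> N" for m n
    proof -
      have "norm (z m - z n) \<le> 2 * b"
        using norm_triangle_ineq4[of "z m" "z n"] b[of m] b[of n] by linarith
      then have "norm (x m - x n) * norm (z m - z n) \<le> norm (x m - x n) * (2 * b)"
        by (intro mult_left_mono) auto
      also have "\<dots> < e\<^sup>2"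
        using N[OF that] \<open>b > 0\<close> by (simp add: field_simps)
      finally have "(norm (A (x m) - A (x n)))\<^sup>2 < e\<^sup>2"
        using est[of m n] by linarith
      then show ?thesis
        using \<open>e > 0\<close> by (simp add: dist_norm power2_less_imp_less)
    qed
    then show "\<exists>N. \<forall>m\<ge>N. \<forall>n\<ge>N. dist (A (x m)) (A (x n)) < e"
      by blast
  qed
  then obtain y where y: "(\<lambda>n. A (x n)) \<longlonglongrightarrow> y"
    using Cauchy_convergent convergent_def by blast
  have l: "fst l \<in> D" "A (fst l) = y"
    using limit_in_D[OF xD lims(1) y] .
  have "cinner (A u) y = cinner u (snd l)" if "u \<in> D" for u
  proof (rule LIMSEQ_unique)
    show "(\<lambda>n. cinner (A u) (A (x n))) \<longlonglongrightarrow> cinner (A u) y"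
      by (intro tendsto_cinner tendsto_const y)
    have "cinner (A u) (A (x n)) = cinner u (z n)" for n
      using xz[of n] that T2_eq_Some_iff by blast
    then show "(\<lambda>n. cinner (A u) (A (x n))) \<longlonglongrightarrow> cinner u (snd l)"
      by (simp add: tendsto_cinner lims)
  qed
  then have "T2 (fst l) = Some (snd l)"
    using l by (simp add: T2_eq_Some_iff)
  then show "l \<in> Map.graph T2"
    using in_graphI by (cases l) fastforce
qed

text \<open>Both directions of the criterion by compact embedding become available for T*T.\<close>

sublocale T2: closed_operator T2
  by unfold_locales (fact linear_T2, fact closed_graph_T2)

text \<open>Von Neumann: project \<open>(h, 0)\<close> orthogonally onto the graph of \<open>T\<close>.\<close>

lemma identity_plus_T2_surj: "\<exists>y. T2 y = Some (h - y)"
proof -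
  have "csubspace (Map.graph T)"
    unfolding complex_vector.subspace_def
  proof (intro conjI ballI allI)
    show "0 \<in> Map.graph T"
      using in_graphI[of T 0 0] linear_T D_0 A_0 by (metis domD option.sel zero_prod_def)
    show "p + q \<in> Map.graph T" if "p \<in> Map.graph T" "q \<in> Map.graph T" for p q
      using that linear_T unfolding linear_operator_def
      by (cases p; cases q) (force intro!: in_graphI dest!: in_graphD)
    show "c *\<^sub>C p \<in> Map.graph T" if "p \<in> Map.graph T" for c p
      using that linear_T unfolding linear_operator_def
      by (cases p) (force intro!: in_graphI dest!: in_graphD simp: scaleC_prod_def)
  qed
  then obtain p where p: "p \<in> Map.graph T" "(h, 0) - p \<in> orthogonal_compl (Map.graph T)"
    using orthogonal_projection_exists[OF _ closed_T] by blast
  define y where "y = fst p"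
  have y: "y \<in> D" "p = (y, A y)"
    using p(1) by (cases p; auto simp: y_def dest: in_graphD)+
  have "cinner (A u) (A y) = cinner u (h - y)" if "u \<in> D" for u
  proof -
    have "(u, A u) \<in> Map.graph T"
      using that by (auto intro: in_graphI)
    then have "cinner ((h, 0) - p) (u, A u) = 0"
      using p(2) unfolding orthogonal_compl_def by blast
    \<comment> \<open>Orthogonality to the graph is, up to conjugation, the weak form of T*T y = h -
      y.\<close>
    then have "cinner (h - y) u = cinner (A y) (A u)"
      by (simp add: y cinner_prod_def cinner_minus_left)
    then show ?thesis
      by (metis cinner_commute)
  qed
  then have "T2 y = Some (h - y)"
    using y by (simp add: T2_eq_Some_iff)
  then show ?thesis ..
qed

text \<open>The energy identity: pair y + T*T y = h with \<open>y\<close>.\<close>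

lemma norm_resolvent:
  assumes "T2 y = Some (h - y)"
  shows "(norm y)\<^sup>2 + (norm (A y))\<^sup>2 = Re (cinner y h)"
  using norm_A_squared[OF assms] by (simp add: cinner_diff_right power2_norm_eq_cinner)

text \<open>A bounded closed operator has closed domain. If \<open>h\<close> is orthogonal to
  \<open>dom T2\<close>, solve y + T*T y = h: the energy identity with <y, h> = 0 gives y = 0, hence
  h = 0. So T*T is everywhere defined, and ||A x||^2 \<le> ||x|| ||T*T x|| bounds T. The
  contrapositive supplies the unboundedness of T*T.\<close>

lemma bounded_T2_imp_bounded:
  assumes "bounded_operator T2"
  shows "bounded_operator T"
proof -
  obtain C where C: "\<And>x. x \<in> dom T2 \<Longrightarrow> norm (the (T2 x)) \<le> C * norm x"
    using assms by (auto simp: bounded_operator_def)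
  have C': "norm (the (T2 x)) \<le> (\<bar>C\<bar> + 1) * norm x" if "x \<in> dom T2" for x
  proof -
    have "C * norm x \<le> (\<bar>C\<bar> + 1) * norm x"
      by (rule mult_right_mono) auto
    with C[OF that] show ?thesis
      by linarith
  qed
  have "closed (dom T2)"
    unfolding closed_sequential_limits
  proof (intro allI impI, elim conjE)
    fix f l assume f: "\<forall>n::nat. f n \<in> dom T2" and lim: "f \<longlonglongrightarrow> l"
    have "Cauchy (\<lambda>n. the (T2 (f n)))"
    proof (rule metric_CauchyI)
      fix e :: real assume "e > 0"
      then have "e / (\<bar>C\<bar> + 1) > 0"
        by simp
      then obtain N where N: "\<And>m n. m \<ge> N \<Longrightarrow> n \<ge> N \<Longrightarrow> norm (f m - f n) < e / (\<bar>C\<bar> + 1)"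
        using LIMSEQ_imp_Cauchy[OF lim] unfolding Cauchy_def dist_norm by meson
      have "dist (the (T2 (f m))) (the (T2 (f n))) < e" if "m \<ge> N" "n \<ge> N" for m n
      proof -
        have "norm (the (T2 (f m)) - the (T2 (f n))) \<le> (\<bar>C\<bar> + 1) * norm (f m - f n)"
          using C'[OF T2.D_diff[OF f[rule_format, of m] f[rule_format, of n]]]
          unfolding T2.A_diff[OF f[rule_format, of m] f[rule_format, of n]] .
        also have "\<dots> < e"
          using N[OF that] by (simp add: pos_less_divide_eq mult.commute)
        finally show ?thesis
          by (simp add: dist_norm)
      qed
      then show "\<exists>N. \<forall>m\<ge>N. \<forall>n\<ge>N. dist (the (T2 (f m))) (the (T2 (f n))) < e"
        by blast
    qed
    then obtain y where y: "(\<lambda>n. the (T2 (f n))) \<longlonglongrightarrow> y"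
      using Cauchy_convergent convergent_def by blast
    show "l \<in> dom T2"
      using T2.limit_in_D(1)[OF _ lim y] f by blast
  qed
  moreover have "orthogonal_compl (dom T2) \<subseteq> {0}"
  proof
    fix h assume h: "h \<in> orthogonal_compl (dom T2)"
    obtain y where y: "T2 y = Some (h - y)"
      using identity_plus_T2_surj ..
    then have "cinner h y = 0"
      using h unfolding orthogonal_compl_def by blast
    then have "cinner y h = 0"
      by (rule cinner_eq_0_sym[THEN iffD1])
    with norm_resolvent[OF y] have "(norm y)\<^sup>2 = 0"
      by (simp add: add_nonneg_eq_0_iff)
    then have "y = 0"
      by simp
    then have "h = the (T2 0)"
      using y by simp
    then show "h \<in> {0}"
      using T2.A_0 by simp
  qed
  ultimately have UNIV: "dom T2 = UNIV"
    using closed_csubspace_UNIV T2.csubspace_D by blast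
  have "norm (A x) \<le> sqrt (\<bar>C\<bar> + 1) * norm x" for x
  proof -
    obtain z where z: "T2 x = Some z"
      using UNIV by blast
    have "(norm (A x))\<^sup>2 \<le> norm x * norm z"
      unfolding norm_A_squared[OF z] by (rule Re_cinner_le)
    also have "\<dots> \<le> norm x * ((\<bar>C\<bar> + 1) * norm x)"
      using C'[of x] z by (intro mult_left_mono) auto
    also have "\<dots> = (sqrt (\<bar>C\<bar> + 1) * norm x)\<^sup>2"
      by (simp add: power_mult_distrib power2_eq_square)
    finally show ?thesis
      by (rule power2_le_imp_le) simp
  qed
  then show ?thesis
    unfolding bounded_operator_def by blast
qed

text \<open>Since ||A x||^2 \<le> ||x|| ||T*T x||, the graph unit ball of T*T is contained in that
  of T.\<close>

lemma compact_embedding_imp_T2: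
  assumes "compact_embedding"
  shows "T2.compact_embedding"
  unfolding T2.compact_embedding_def
proof (rule compact_closure_subset[OF assms[unfolded compact_embedding_def]], intro subsetI CollectI)
  fix x assume x: "x \<in> {x \<in> dom T2. norm x \<le> 1 \<and> norm (the (T2 x)) \<le> 1}"
  then obtain z where z: "T2 x = Some z" "norm x \<le> 1" "norm z \<le> 1"
    by auto
  have "(norm (A x))\<^sup>2 \<le> norm x * norm z"
    unfolding norm_A_squared[OF z(1)] by (rule Re_cinner_le)
  also have "\<dots> \<le> 1\<^sup>2"
    using z by (simp add: mult_le_one)
  finally have "norm (A x) \<le> 1"
    by (rule power2_le_imp_le) simp
  then show "x \<in> D \<and> norm x \<le> 1 \<and> norm (A x) \<le> 1"
    using z T2_eq_Some_iff by blast
qed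

text \<open>With \<open>y n = (1 + T\<^sup>*T)\<^sup>-\<^sup>1 (w n)\<close>, convergence of \<open>y n\<close> in \<open>H\<close> forces convergence in graph norm,
  and pairing \<open>w n\<close> with \<open>y n\<close> in the graph inner product gives back the norm of \<open>w n\<close>.\<close>

lemma T2_imp_compact_embedding:
  assumes "T2.compact_embedding"
  shows "compact_embedding"
  unfolding compact_embedding_def
proof (rule compact_closure_sequentially)
  fix w :: "nat \<Rightarrow> 'a" assume "\<And>n. w n \<in> {x \<in> D. norm x \<le> 1 \<and> norm (A x) \<le> 1}"
  then have w: "w n \<in> D" "norm (w n) \<le> 1" "norm (A (w n)) \<le> 1" for n
    by auto
  have "\<forall>n. \<exists>y. T2 y = Some (w n - y)"
    by (intro allI identity_plus_T2_surj)
  from choice[OF this] obtain y where y: "\<And>n. T2 (y n) = Some (w n - y n)"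
    by blast
  have ny: "norm (y n) \<le> 1" for n
  proof -
    have "(norm (y n))\<^sup>2 \<le> norm (y n) * norm (w n)"
      using norm_resolvent[OF y, of n] Re_cinner_le[of "y n" "w n"] zero_le_power2[of "norm (A (y n))"]
      by linarith
    also have "\<dots> \<le> norm (y n) * 1"
      using w(2) by (intro mult_left_mono) auto
    finally show ?thesis
      using mult_le_cancel_left_pos[of "norm (y n)" "norm (y n)" 1]
      by (cases "y n = 0") (simp_all add: power2_eq_square)
  qed
  have "norm (the (T2 (y n))) \<le> 2" for n
    using norm_triangle_ineq4[of "w n" "y n"] w(2)[of n] ny[of n] by (simp add: y)
  moreover have "norm (y n) \<le> 2" "y n \<in> dom T2" for n
    using ny[of n] y by (auto simp: domIff)
  ultimately obtain r l where r: "strict_mono (r :: nat \<Rightarrow> nat)" "(y \<circ> r) \<longlonglongrightarrow> l"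
    using T2.convergent_subsequence[OF assms, of y 2] by metis
  have est: "(norm (w i - w j))\<^sup>2 \<le> 2 * norm (y i - y j) + 2 * sqrt (2 * norm (y i - y j))" for i j
  proof -
    define g d where "g = w i - w j" and "d = y i - y j"
    have d: "T2 d = Some (g - d)"
      using T2_diff[OF y[of i] y[of j]] by (simp add: d_def g_def algebra_simps)
    have gD: "g \<in> D"
      using w by (simp add: g_def D_diff)
    have ng: "norm g \<le> 2" "norm (A g) \<le> 2"
      using norm_triangle_ineq4[of "w i" "w j"] norm_triangle_ineq4[of "A (w i)" "A (w j)"]
        w(2)[of i] w(2)[of j] w(3)[of i] w(3)[of j] w(1) by (simp_all add: g_def A_diff)
    have "(norm (A d))\<^sup>2 \<le> norm d * norm g"
      using norm_resolvent[OF d] Re_cinner_le[of d g] zero_le_power2[of "norm d"] by linarith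
    also have "\<dots> \<le> norm d * 2"
      using ng by (intro mult_left_mono) auto
    \<comment> \<open>The energy identity bounds the image of \<open>d\<close> by the square root of
      its norm; this is how smallness in H alone gives smallness in graph norm.\<close>
    finally have nAd: "norm (A d) \<le> sqrt (2 * norm d)"
      by (intro real_le_rsqrt) simp
    have "cinner (A g) (A d) = cinner g (g - d)"
      using d gD T2_eq_Some_iff by blast
    then have "(norm g)\<^sup>2 = Re (cinner g d) + Re (cinner (A g) (A d))"
      by (simp add: cinner_diff_right power2_norm_eq_cinner)
    also have "\<dots> \<le> norm g * norm d + norm (A g) * norm (A d)"
      by (intro add_mono Re_cinner_le)
    also have "\<dots> \<le> 2 * norm d + 2 * sqrt (2 * norm d)"
      using ng nAd by (intro add_mono mult_mono) auto
    finally show ?thesis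
      unfolding g_def d_def .
  qed
  have "Cauchy (w \<circ> r)"
  proof (rule metric_CauchyI)
    fix e :: real assume "e > 0"
    \<comment> \<open>The two bounds make each summand of \<open>est\<close> at most e^2/4.\<close>
    define \<delta> where "\<delta> = min (e\<^sup>2 / 8) ((e\<^sup>2 / 8)\<^sup>2 / 2)"
    have "\<delta> > 0"
      using \<open>e > 0\<close> by (simp add: \<delta>_def)
    then obtain N where N: "\<And>m n. m \<ge> N \<Longrightarrow> n \<ge> N \<Longrightarrow> norm (y (r m) - y (r n)) < \<delta>"
      using LIMSEQ_imp_Cauchy[OF r(2)] unfolding Cauchy_def dist_norm o_def by meson
    have "dist ((w \<circ> r) m) ((w \<circ> r) n) < e" if "m \<ge> N" "n \<ge> N" for m n
    proof -
      let ?d = "norm (y (r m) - y (r n))"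
      have d: "?d \<le> e\<^sup>2 / 8" "2 * ?d \<le> (e\<^sup>2 / 8)\<^sup>2"
        using N[OF that] by (auto simp: \<delta>_def)
      have "sqrt (2 * ?d) \<le> e\<^sup>2 / 8"
        using d(2) by (intro real_le_lsqrt) auto
      then have "(norm (w (r m) - w (r n)))\<^sup>2 \<le> e\<^sup>2 / 2"
        using est[of "r m" "r n"] d(1) by linarith
      also have "\<dots> < e\<^sup>2"
        using \<open>e > 0\<close> by simp
      finally show ?thesis
        using \<open>e > 0\<close> by (simp add: dist_norm power2_less_imp_less)
    qed
    then show "\<exists>N. \<forall>m\<ge>N. \<forall>n\<ge>N. dist ((w \<circ> r) m) ((w \<circ> r) n) < e"
      by blast
  qed
  with r(1) show "\<exists>r::nat \<Rightarrow> nat. strict_mono r \<and> Cauchy (w \<circ> r)"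
    by blast
qed

end

section \<open>The Moore-Penrose inverse of an injective closed operator\<close>

locale injective_closed_operator = densely_defined_closed_operator +
  assumes inj: "inj_on T (dom T)"
begin

lemma A_eq_0: "x \<in> D \<Longrightarrow> A x = 0 \<Longrightarrow> x = 0"
  using inj D_0 A_0 unfolding inj_on_def by (metis domD option.sel)

lemma null_space_T: "null_space T = {0}"
proof -
  have "T 0 = Some 0"
    using linear_T D_0 A_0 by (metis domD option.sel)
  then show ?thesis
    using A_eq_0 by (fastforce simp: null_space_def)
qed

abbreviation "Rperp \<equiv> orthogonal_compl (ran T)"

lemma ran_eq: "ran T = (\<lambda>x. A x) ` D"
  by (force simp: ran_def image_def dom_def)

lemma A_in_closure_ran: "x \<in> D \<Longrightarrow> A x \<in> closure (ran T)"
  by (rule subsetD[OF closure_subset]) (simp add: ran_eq)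

lemma csubspace_ran: "csubspace (ran T)"
  unfolding complex_vector.subspace_def ran_eq
proof (intro conjI ballI allI)
  show "0 \<in> (\<lambda>x. A x) ` D"
    by (rule image_eqI[of _ _ 0]) simp_all
  show "u + v \<in> (\<lambda>x. A x) ` D" if "u \<in> (\<lambda>x. A x) ` D" "v \<in> (\<lambda>x. A x) ` D" for u v
    using that A_add D_add by (elim imageE) (metis image_eqI)
  show "c *\<^sub>C u \<in> (\<lambda>x. A x) ` D" if "u \<in> (\<lambda>x. A x) ` D" for c u
    using that A_scaleC D_scaleC by (elim imageE) (metis image_eqI)
qed

text \<open>The value is the least squares solution of A x = y, unique because T is injective. This
  explicit operator is later identified with \<open>moore_penrose_inverse T\<close>.\<close>

definition pinv :: "'a \<rightharpoonup> 'a" where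
  "pinv y = (if \<exists>x\<in>D. y - A x \<in> Rperp then Some (THE x. x \<in> D \<and> y - A x \<in> Rperp) else None)"

lemma pinv_eq_Some_iff: "pinv y = Some x \<longleftrightarrow> x \<in> D \<and> y - A x \<in> Rperp"
proof -
  have unique: "x = x'" if "x \<in> D" "y - A x \<in> Rperp" "x' \<in> D" "y - A x' \<in> Rperp" for x x'
  proof -
    have "A (x - x') = (y - A x') - (y - A x)"
      using that by (simp add: A_diff)
    then have "A (x - x') \<in> Rperp"
      using csubspace_diff[OF csubspace_orthogonal_compl that(4,2)] by simp
    moreover have "A (x - x') \<in> closure (ran T)"
      using that D_diff A_in_closure_ran by blast
    ultimately show ?thesis
      using orthogonal_compl_disjoint A_eq_0[of "x - x'"] that D_diff by auto
  qed
  show ?thesis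
  proof
    assume l: "pinv y = Some x"
    then have ex: "\<exists>x. x \<in> D \<and> y - A x \<in> Rperp"
      by (auto simp: pinv_def split: if_splits)
    then have "x = (THE x. x \<in> D \<and> y - A x \<in> Rperp)"
      using l by (auto simp: pinv_def split: if_splits)
    moreover have "\<exists>!x. x \<in> D \<and> y - A x \<in> Rperp"
      using ex unique by blast
    ultimately show "x \<in> D \<and> y - A x \<in> Rperp"
      using theI'[of "\<lambda>x. x \<in> D \<and> y - A x \<in> Rperp"] by simp
  next
    assume r: "x \<in> D \<and> y - A x \<in> Rperp"
    then have "(THE x. x \<in> D \<and> y - A x \<in> Rperp) = x"
      using unique by (intro the_equality) auto
    with r show "pinv y = Some x"
      by (auto simp: pinv_def)
  qed
qed

text \<open>By Pythagoras, since \<open>A x\<close> is the orthogonal projection of \<open>y\<close>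
  onto the closure of the range.\<close>

lemma norm_A_pinv_le:
  assumes "pinv y = Some x"
  shows "norm (A x) \<le> norm y"
proof -
  have x: "x \<in> D" "y - A x \<in> Rperp"
    using assms by (simp_all add: pinv_eq_Some_iff)
  then have "cinner (y - A x) (A x) = 0"
    by (auto simp: orthogonal_compl_def ran_eq)
  from norm_add_squared_orthogonal[OF this] have "(norm (A x))\<^sup>2 \<le> (norm y)\<^sup>2"
    by simp
  then show ?thesis
    by (rule power2_le_imp_le) simp
qed

lemma pinv_A: "x \<in> D \<Longrightarrow> pinv (A x) = Some x"
  using complex_vector.subspace_0[OF csubspace_orthogonal_compl] by (simp add: pinv_eq_Some_iff)

lemma linear_pinv: "linear_operator pinv"
proof (rule linear_operatorI)
  show "pinv 0 = Some 0"
    using pinv_A[OF D_0] by simp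
  show "pinv (x + y) = Some (a + b)" if "pinv x = Some a" "pinv y = Some b" for x y a b
    using that complex_vector.subspace_add[OF csubspace_orthogonal_compl, of "x - A a" "ran T" "y - A b"]
    unfolding pinv_eq_Some_iff by (simp add: D_add A_add algebra_simps)
  show "pinv (c *\<^sub>C x) = Some (c *\<^sub>C a)" if "pinv x = Some a" for c x a
    using that complex_vector.subspace_scale[OF csubspace_orthogonal_compl, of "x - A a" "ran T" c]
    unfolding pinv_eq_Some_iff by (simp add: D_scaleC A_scaleC complex_vector.scale_right_diff_distrib)
qed

lemma dom_pinv: "dom pinv = {u + v | u v. u \<in> ran T \<and> v \<in> Rperp}"
proof (intro set_eqI iffI)
  fix y assume "y \<in> dom pinv"
  then obtain x where "x \<in> D" "y - A x \<in> Rperp"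
    using pinv_eq_Some_iff by blast
  then show "y \<in> {u + v | u v. u \<in> ran T \<and> v \<in> Rperp}"
    by (intro CollectI exI[of _ "A x"] exI[of _ "y - A x"]) (simp add: ran_eq)
next
  fix y assume "y \<in> {u + v | u v. u \<in> ran T \<and> v \<in> Rperp}"
  then obtain x v where "x \<in> D" "y = A x + v" "v \<in> Rperp"
    unfolding ran_eq by blast
  then have "x \<in> D" "y - A x \<in> Rperp"
    by (simp_all del: mem_Collect_eq)
  then show "y \<in> dom pinv"
    using pinv_eq_Some_iff by blast
qed

text \<open>Convergence of the \<open>y n\<close> forces convergence of their projections
  \<open>A (x n)\<close>. Closedness of T then identifies the limit, and orthogonality of the
  remainders to the range is preserved.\<close>

lemma closed_graph_pinv: "closed (Map.graph pinv)"
  unfolding closed_sequential_limits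
proof (intro allI impI, elim conjE)
  fix f l assume f: "\<forall>n::nat. f n \<in> Map.graph pinv" and lim: "f \<longlonglongrightarrow> l"
  define y x where "y = (\<lambda>n. fst (f n))" and "x = (\<lambda>n. snd (f n))"
  have xy: "pinv (y n) = Some (x n)" for n
    using f[rule_format, of n] by (cases "f n") (auto simp: x_def y_def dest: in_graphD)
  have lims: "y \<longlonglongrightarrow> fst l" "x \<longlonglongrightarrow> snd l"
    unfolding x_def y_def by (intro tendsto_intros lim)+
  have x: "x n \<in> D" "y n - A (x n) \<in> Rperp" for n
    using xy[of n] by (simp_all add: pinv_eq_Some_iff)
  have est: "norm (A (x m) - A (x n)) \<le> norm (y m - y n)" for m n
  proof -
    have "(y m - A (x m)) - (y n - A (x n)) \<in> Rperp"
      by (intro csubspace_diff[OF csubspace_orthogonal_compl] x)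
    then have "pinv (y m - y n) = Some (x m - x n)"
      using x by (simp add: pinv_eq_Some_iff D_diff A_diff algebra_simps)
    from norm_A_pinv_le[OF this] show ?thesis
      using x by (simp add: A_diff)
  qed
  have "Cauchy (\<lambda>n. A (x n))"
    using LIMSEQ_imp_Cauchy[OF lims(1)] est unfolding Cauchy_def dist_norm by (meson le_less_trans)
  then obtain a where a: "(\<lambda>n. A (x n)) \<longlonglongrightarrow> a"
    using Cauchy_convergent convergent_def by blast
  have l: "snd l \<in> D" "A (snd l) = a"
    using limit_in_D[OF x(1) lims(2) a] .
  have "cinner (fst l - a) u = 0" if "u \<in> ran T" for u
  proof (rule LIMSEQ_unique)
    show "(\<lambda>n. cinner (y n - A (x n)) u) \<longlonglongrightarrow> cinner (fst l - a) u"
      by (intro tendsto_cinner tendsto_diff tendsto_const lims a)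
    show "(\<lambda>n. cinner (y n - A (x n)) u) \<longlonglongrightarrow> 0"
      using x(2) that by (simp add: orthogonal_compl_def)
  qed
  then have "pinv (fst l) = Some (snd l)"
    using l by (simp add: pinv_eq_Some_iff orthogonal_compl_def)
  then show "l \<in> Map.graph pinv"
    using in_graphI by (cases l) fastforce
qed

text \<open>A vector orthogonal to the domain is orthogonal to the range of T, hence itself in the
  domain with value 0, and so orthogonal to itself.\<close>

lemma dense_dom_pinv: "closure (dom pinv) = UNIV"
proof (rule closed_csubspace_UNIV)
  show "csubspace (closure (dom pinv))"
    using linear_pinv by (simp add: csubspace_closure linear_operator_def)
  show "orthogonal_compl (closure (dom pinv)) \<subseteq> {0}"
  proof
    fix z assume z: "z \<in> orthogonal_compl (closure (dom pinv))"
    have dom: "A x \<in> dom pinv" if "x \<in> D" for x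
      using pinv_A[OF that] by blast
    have "z \<in> Rperp"
      using z dom unfolding orthogonal_compl_closure by (auto simp: orthogonal_compl_def ran_eq)
    then have "pinv z = Some 0"
      by (simp add: pinv_eq_Some_iff)
    then have "z \<in> closure (dom pinv)"
      by (intro subsetD[OF closure_subset] domI)
    with z show "z \<in> {0}"
      using orthogonal_compl_disjoint[of z "dom pinv"] by (simp add: orthogonal_compl_closure)
  qed
qed simp

lemma ortho_proj_closure_ran:
  assumes "x \<in> D" "y - A x \<in> Rperp"
  shows "ortho_proj (closure (ran T)) y = A x"
proof (rule ortho_proj_unique)
  show "csubspace (closure (ran T))"
    by (rule csubspace_closure[OF csubspace_ran])
  show "A x \<in> closure (ran T)"
    using assms(1) by (rule A_in_closure_ran)
  show "y - A x \<in> orthogonal_compl (closure (ran T))"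
    using assms(2) by (simp add: orthogonal_compl_closure)
qed

text \<open>Any candidate \<open>S\<close> has the domain of \<open>pinv\<close>, and there T S y is
  the projection of \<open>y\<close> onto the closure of the range, which equals T (pinv y).
  Injectivity of T gives \<open>S = pinv\<close>.\<close>

lemma moore_penrose_inverse_eq: "moore_penrose_inverse T = pinv"
  unfolding moore_penrose_inverse_def
proof (rule the_equality)
  show "is_moore_penrose_inverse T pinv"
    unfolding is_moore_penrose_inverse_def
  proof (intro conjI ballI)
    show "densely_defined_closed pinv"
      by (simp add: densely_defined_closed_def linear_pinv dense_dom_pinv closed_graph_pinv)
    show "(T \<circ>\<^sub>m pinv) y = Some (ortho_proj (closure (ran T)) y)" if "y \<in> dom pinv" for y
    proof -
      obtain x where x: "pinv y = Some x"
        using \<open>y \<in> dom pinv\<close> by blast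
      then have "ortho_proj (closure (ran T)) y = A x" "x \<in> D"
        using ortho_proj_closure_ran by (simp_all add: pinv_eq_Some_iff)
      with x show ?thesis
        by auto
    qed
    show "(pinv \<circ>\<^sub>m T) x = Some (ortho_proj (orthogonal_compl (null_space T)) x)" if "x \<in> D" for x
    proof -
      have "orthogonal_compl (null_space T) = UNIV"
        by (auto simp: null_space_T orthogonal_compl_def)
      moreover have "ortho_proj UNIV x = x"
        using csubspace_orthogonal_compl by (intro ortho_proj_unique) (auto simp: orthogonal_compl_def)
      ultimately show ?thesis
        using pinv_A[OF that] that by auto
    qed
    show "null_space pinv = Rperp"
      by (simp add: null_space_def pinv_eq_Some_iff)
  qed (rule dom_pinv)
next
  fix S assume S: "is_moore_penrose_inverse T S"
  then have dom_eq: "dom S = dom pinv"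
    by (simp add: is_moore_penrose_inverse_def dom_pinv)
  show "S = pinv"
  proof (rule map_le_antisym)
    show "S \<subseteq>\<^sub>m pinv"
      unfolding map_le_def
    proof
      fix y assume y: "y \<in> dom S"
      then obtain x where x: "S y = Some x"
        by blast
      obtain x' where x': "x' \<in> D" "y - A x' \<in> Rperp" "pinv y = Some x'"
        using y unfolding dom_eq by (auto simp: pinv_eq_Some_iff domIff)
      have "(T \<circ>\<^sub>m S) y = Some (ortho_proj (closure (ran T)) y)"
        using S y by (simp add: is_moore_penrose_inverse_def)
      then have "T x = Some (A x')"
        using x ortho_proj_closure_ran[OF x'(1,2)] by simp
      then have "x = x'"
        using inj x'(1) unfolding inj_on_def by (metis domD domI option.sel)
      then show "S y = pinv y"
        using x x' by simp
    qed
    then show "pinv \<subseteq>\<^sub>m S"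
      using dom_eq by (simp add: map_le_def)
  qed
qed

text \<open>Since x = pinv (A x), the graph unit ball of T lies in the image of the unit ball under
  \<open>pinv\<close>.\<close>

lemma compact_pinv_imp_compact_embedding:
  assumes "compact_operator pinv"
  shows "compact_embedding"
proof -
  have "compact (closure ((\<lambda>y. the (pinv y)) ` cball 0 1))"
    using assms bounded_cball unfolding compact_operator_def by blast
  moreover have "{x \<in> D. norm x \<le> 1 \<and> norm (A x) \<le> 1} \<subseteq> (\<lambda>y. the (pinv y)) ` cball 0 1"
  proof
    fix x assume "x \<in> {x \<in> D. norm x \<le> 1 \<and> norm (A x) \<le> 1}"
    then show "x \<in> (\<lambda>y. the (pinv y)) ` cball 0 1"
      using pinv_A by (intro image_eqI[of _ _ "A x"]) auto
  qed
  ultimately show ?thesis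
    unfolding compact_embedding_def by (rule compact_closure_subset)
qed

text \<open>The lower bound for T makes its range closed, so the projection theorem makes
  \<open>pinv\<close> everywhere defined, and the same constant bounds it. As
  \<open>norm (A (pinv y)) \<le> norm y\<close>, \<open>pinv\<close> maps bounded sets to sets
  bounded in graph norm.\<close>

lemma compact_embedding_imp_compact_pinv:
  assumes "compact_embedding"
  shows "compact_operator pinv"
proof -
  obtain c where "c > 0" and c: "\<And>x. x \<in> D \<Longrightarrow> norm x \<le> c * norm (A x)"
    using compact_embedding_imp_bounded_below[OF assms A_eq_0] by blast
  have closed_ran: "closed (ran T)"
    unfolding closed_sequential_limits
  proof (intro allI impI, elim conjE)
    fix f l assume f: "\<forall>n::nat. f n \<in> ran T" and lim: "f \<longlonglongrightarrow> l"
    obtain x where x: "\<And>n. x n \<in> D" "\<And>n. f n = A (x n)"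
      using f unfolding ran_eq image_iff by metis
    have "Cauchy x"
    proof (rule metric_CauchyI)
      fix e :: real assume "e > 0"
      then have "e / c > 0"
        using \<open>c > 0\<close> by simp
      then obtain N where N: "\<And>m n. m \<ge> N \<Longrightarrow> n \<ge> N \<Longrightarrow> norm (f m - f n) < e / c"
        using LIMSEQ_imp_Cauchy[OF lim] unfolding Cauchy_def dist_norm by meson
      have "dist (x m) (x n) < e" if "m \<ge> N" "n \<ge> N" for m n
      proof -
        have "norm (x m - x n) \<le> c * norm (f m - f n)"
          using c[of "x m - x n"] x by (simp add: D_diff A_diff)
        also have "\<dots> < e"
          using N[OF that] \<open>c > 0\<close> by (simp add: pos_less_divide_eq mult.commute)
        finally show ?thesis
          by (simp add: dist_norm)
      qed
      then show "\<exists>N. \<forall>m\<ge>N. \<forall>n\<ge>N. dist (x m) (x n) < e"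
        by blast
    qed
    then obtain x0 where x0: "x \<longlonglongrightarrow> x0"
      using Cauchy_convergent convergent_def by blast
    have "(\<lambda>n. A (x n)) \<longlonglongrightarrow> l"
      using lim x(2) by (simp flip: x(2))
    then have "x0 \<in> D" "A x0 = l"
      by (rule limit_in_D[OF x(1) x0])+
    then show "l \<in> ran T"
      unfolding ran_eq by blast
  qed
  have dom: "dom pinv = UNIV"
  proof -
    have "y \<in> dom pinv" for y
    proof -
      obtain p where "p \<in> ran T" "y - p \<in> Rperp"
        using orthogonal_projection_exists[OF csubspace_ran closed_ran] .
      then obtain x where "pinv y = Some x"
        using pinv_eq_Some_iff unfolding ran_eq by blast
      then show ?thesis
        by blast
    qed
    then show ?thesis
      by blast
  qed
  have pinv: "pinv y = Some (the (pinv y))" for y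
    using dom by (metis UNIV_I domD option.sel)
  have bound: "norm (the (pinv y)) \<le> c * norm y" for y
  proof -
    have "the (pinv y) \<in> D"
      using pinv[of y] pinv_eq_Some_iff by blast
    then have "norm (the (pinv y)) \<le> c * norm (A (the (pinv y)))"
      by (rule c)
    also have "\<dots> \<le> c * norm y"
      using norm_A_pinv_le[OF pinv] \<open>c > 0\<close> by simp
    finally show ?thesis .
  qed
  have "compact (closure ((\<lambda>y. the (pinv y)) ` B))" if "bounded B" for B
  proof (rule compact_closure_sequentially)
    fix w :: "nat \<Rightarrow> 'a" assume "\<And>n. w n \<in> (\<lambda>y. the (pinv y)) ` B"
    then obtain y where y: "\<And>n. y n \<in> B" "\<And>n. w n = the (pinv (y n))"
      unfolding image_iff by metis
    obtain b where b: "\<And>z. z \<in> B \<Longrightarrow> norm z \<le> b"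
      using \<open>bounded B\<close> by (auto simp: bounded_iff)
    have "w n \<in> D" for n
      using pinv[of "y n"] pinv_eq_Some_iff y(2) by metis
    moreover have "norm (w n) \<le> max (c * b) b" for n
    proof -
      have "norm (w n) \<le> c * norm (y n)"
        using bound y(2) by simp
      also have "\<dots> \<le> c * b"
        using b[OF y(1)] \<open>c > 0\<close> by (intro mult_left_mono) auto
      finally show ?thesis
        by simp
    qed
    moreover have "norm (A (w n)) \<le> max (c * b) b" for n
      using norm_A_pinv_le[OF pinv, of "y n"] b[OF y(1)[of n]] y(2)[of n] by simp
    ultimately obtain r l where "strict_mono (r :: nat \<Rightarrow> nat)" "(w \<circ> r) \<longlonglongrightarrow> l"
      using convergent_subsequence[OF assms, of w "max (c * b) b"] by metis
    then show "\<exists>r::nat \<Rightarrow> nat. strict_mono r \<and> Cauchy (w \<circ> r)"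
      using LIMSEQ_imp_Cauchy by blast
  qed
  then show ?thesis
    unfolding compact_operator_def bounded_operator_def
    using linear_pinv dom bound by blast
qed

end

theorem theorem4p9:
  fixes T :: "'a::complex_hilbert_space \<rightharpoonup> 'a"
  assumes infinite_dim: "\<not> (\<exists>B::'a set. finite B \<and> cspan B = UNIV)"
    and closed_op: "densely_defined_closed T"
    and one_to_one: "inj_on T (dom T)"
    and unbounded: "\<not> bounded_operator T"
  shows "(absolutely_minimum_attaining T \<longleftrightarrow>
            absolutely_minimum_attaining (adjoint_operator T \<circ>\<^sub>m T)) \<and>
         (absolutely_minimum_attaining T \<longleftrightarrow>
            compact_operator (moore_penrose_inverse T))"
proof -
  interpret injective_closed_operator T
    using closed_op one_to_one by unfold_locales (simp_all add: densely_defined_closed_def)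
  have "absolutely_minimum_attaining T \<longleftrightarrow> compact_embedding"
    using compact_embedding_imp_absolutely_minimum_attaining
      absolutely_minimum_attaining_imp_compact_embedding[OF unbounded] by blast
  \<comment> \<open>The necessity direction for T*T uses that T*T is unbounded, which follows from
    the unboundedness of T.\<close>
  moreover have "absolutely_minimum_attaining T2 \<longleftrightarrow> T2.compact_embedding"
    using T2.compact_embedding_imp_absolutely_minimum_attaining
      T2.absolutely_minimum_attaining_imp_compact_embedding bounded_T2_imp_bounded unbounded by blast
  moreover have "compact_embedding \<longleftrightarrow> T2.compact_embedding"
    using compact_embedding_imp_T2 T2_imp_compact_embedding by blast
  moreover have "compact_operator (moore_penrose_inverse T) \<longleftrightarrow> compact_embedding"
    unfolding moore_penrose_inverse_eq
    using compact_pinv_imp_compact_embedding compact_embedding_imp_compact_pinv by blast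
  ultimately show ?thesis
    by blast
qed

end
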